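(* Let $r \ge 2$ and $s_r \ge \cdots \ge s_1 \ge 1$ be integers, let $s := s_1+\cdots+s_r$, and let $\mathbb{B}$ be an $r$-partite $r$-graph with part sizes $s_1,\ldots,s_r$. Then there is $n_0$ such that for every $n\ge n_0$, $$\mathrm{ex}(n,(t+1)\mathbb{B}) \le \binom{s(t+1)-1}{r} + \mathrm{ex}_{\mathrm{star}}\left(n-st,\ n,\ s\mathbb{B}\right)$$ holds for all integers $t$ satisfying $$\frac{n}{s} - \frac{n}{16 e^2 r^4 s^2\prod_{i\in[r]} s_i} \le t \le \frac{n}{s}.$$
   Context: An $r$-graph is a set of $r$-element subsets (edges) of a finite vertex set. An $r$-partite $r$-graph with part sizes $s_1,\ldots,s_r$ has vertex set partitioned into $W_1,\ldots,W_r$ with $|W_i|=s_i$, every edge containing exactly one vertex of each $W_i$. $s\mathbb{B}$ denotes the $r$-graph consisting of $s$ pairwise vertex-disjoint copies of $\mathbb{B}$. An $n$-vertex $r$-graph $\mathcal{H}$ is an $m$-star if there is a set $V_1\subseteq V(\mathcal{H})$ with $|V_1|=m$ such that every edge of $\mathcal{H}$ contains at least one vertex of $V_1$. $\mathrm{ex}_{\mathrm{star}}(m,n,F)$ is the maximum number of edges in an $n$-vertex $r$-uniform $m$-star containing no copy of $F$. $\mathrm{ex}(n,(t+1)F)$ is the maximum number of edges in an $n$-vertex $r$-graph not containing $t+1$ pairwise vertex-disjoint copies of $F$. $e$ is Euler's number. *)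

theory Defs
  imports Complex_Main
begin

definition rgraph :: "nat \<Rightarrow> 'a set \<Rightarrow> 'a set set \<Rightarrow> bool" where
  "rgraph r V E \<longleftrightarrow> finite V \<and> (\<forall>e\<in>E. e \<subseteq> V \<and> card e = r)"

definition contains :: "('a set \<times> 'a set set) \<Rightarrow> ('b set \<times> 'b set set) \<Rightarrow> bool" where
  "contains H F \<longleftrightarrow> (\<exists>f. inj_on f (fst F) \<and> f ` fst F \<subseteq> fst H \<and>
                          (\<forall>e\<in>snd F. f ` e \<in> snd H))"

definition copies :: "nat \<Rightarrow> ('b set \<times> 'b set set) \<Rightarrow> ((nat \<times> 'b) set \<times> (nat \<times> 'b) set set)" where
  "copies k F = ({..<k} \<times> fst F, {(\<lambda>x. (i, x)) ` e | i e. i < k \<and> e \<in> snd F})"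

definition rpartite :: "nat \<Rightarrow> (nat \<Rightarrow> nat) \<Rightarrow> 'a set \<Rightarrow> 'a set set \<Rightarrow> bool" where
  "rpartite r sz V E \<longleftrightarrow> rgraph r V E \<and>
     (\<exists>W :: nat \<Rightarrow> 'a set. V = (\<Union>i<r. W i) \<and>
        (\<forall>i<r. \<forall>j<r. i \<noteq> j \<longrightarrow> W i \<inter> W j = {}) \<and>
        (\<forall>i<r. card (W i) = sz i) \<and>
        (\<forall>e\<in>E. \<forall>i<r. card (e \<inter> W i) = 1))"

definition ex_num :: "nat \<Rightarrow> nat \<Rightarrow> ('b set \<times> 'b set set) \<Rightarrow> nat" where
  "ex_num r n F = Sup {card E | E. rgraph r {..<n} E \<and> \<not> contains ({..<n}, E) F}"

definition is_star :: "nat \<Rightarrow> nat \<Rightarrow> nat set set \<Rightarrow> bool" where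
  "is_star m n E \<longleftrightarrow> (\<exists>V1 \<subseteq> {..<n}. card V1 = m \<and> (\<forall>e\<in>E. e \<inter> V1 \<noteq> {}))"

definition ex_star :: "nat \<Rightarrow> nat \<Rightarrow> nat \<Rightarrow> ('b set \<times> 'b set set) \<Rightarrow> nat" where
  "ex_star r m n F = Sup {card E | E. rgraph r {..<n} E \<and> is_star m n E \<and> \<not> contains ({..<n}, E) F}"

end

theory Submission
  imports Defs "HOL-Combinatorics.Permutations" "HOL-Library.Disjoint_Sets" "HOL-Library.FuncSet"
begin

text \<open>
Write \<open>m = n - s t\<close>, let \<open>V\<^sub>1\<close> be a set of \<open>m\<close> vertices of smallest degree of a \<open>(t+1)B\<close>-free
graph, and let \<open>U\<close> be its complement, so that \<open>U\<close> spans at most \<open>s t choose r\<close> edges. If the star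
of edges meeting \<open>V\<^sub>1\<close> is \<open>sB\<close>-free, we are done. Otherwise, a graph with more edges than claimed
is nearly complete, so almost all vertices of \<open>U\<close> have nearly full degree. By the lopsided local
lemma for random permutations, any large set of such vertices can be tiled with copies of \<open>B\<close>.
A vertex of \<open>U\<close> of lower degree still lies in a copy of \<open>B\<close> avoiding any given small set, by the
theorem of Erdos on complete \<open>r\<close>-partite subgraphs, unless its degree is very small; let \<open>Q\<close> be the
set of the exceptions. Each copy of \<open>B\<close> in the star uses a vertex of \<open>V\<^sub>1\<close> and so saves a vertex
of \<open>U\<close>. Hence \<open>|Q| + s\<close> disjoint copies in the star extend to \<open>t + 1\<close> disjoint copies in the
graph. If there are fewer, removing all but \<open>s - 1\<close> of a maximum family leaves an \<open>sB\<close>-free star and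
deletes few edges, which is incompatible with the many edges missing at \<open>Q\<close> inside \<open>U\<close>.
\<close>

section \<open>Degree counts\<close>

text \<open>The number |Q| + s of star copies comes from a count. After they are placed, the rest of
  U outside Q must be tiled, and of the vertices of V1 that they meet, |Q| pay for leaving Q untiled
  and s pay for copy number t + 1. The obstacle is a circular threshold. A copy through a vertex can
  be forced once its degree is at least a share \<zeta> of the full degree D. This \<zeta> must
  allow for all vertices used before, so it grows with the number b of vertices that the tiling
  cannot absorb; b in turn is controlled by edges missing inside U. The loop closes because a
  nonempty Q forces every vertex of V1 to have degree below \<zeta> D. A graph with too many edges
  then misses fewer than m \<zeta> D edges inside U, which makes b small in terms of \<zeta>. The
  local lemma tolerates a share 1/(16 r P) of missing edges at each vertex, where P is the product
  of the part sizes. The lower bound on t enters as m \<le> n/(100 r^4 s P), since 16 e^2 \<ge>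
  100.\<close>

lemma sum_degrees:
  assumes "finite X" "finite G"
  shows "(\<Sum>x\<in>X. card {e\<in>G. x \<in> e}) = (\<Sum>e\<in>G. card (e \<inter> X))"
proof -
  have "(\<Sum>x\<in>X. card {e\<in>G. x \<in> e}) = (\<Sum>x\<in>X. \<Sum>e\<in>G. if x \<in> e then 1 else 0)"
    using assms by (intro sum.cong) (auto simp: sum.If_cases Int_def)
  also have "\<dots> = (\<Sum>e\<in>G. \<Sum>x\<in>X. if x \<in> e then 1 else 0)"
    by (rule sum.swap)
  also have "\<dots> = (\<Sum>e\<in>G. card (e \<inter> X))"
    using assms by (intro sum.cong) (auto simp: sum.If_cases Int_def conj_commute)
  finally show ?thesis .
qed

lemma sum_degrees_uniform:
  assumes "finite X" "finite G" "\<And>e. e \<in> G \<Longrightarrow> e \<subseteq> X \<and> card e = r"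
  shows "(\<Sum>x\<in>X. card {e\<in>G. x \<in> e}) = r * card G"
proof -
  have "(\<Sum>e\<in>G. card (e \<inter> X)) = (\<Sum>e\<in>G. r)"
    using assms(3) by (intro sum.cong) (auto simp: Int_absorb2)
  then show ?thesis
    using sum_degrees[OF assms(1,2)] by simp
qed

lemma sum_degrees_le:
  assumes "finite X" "finite G" "\<And>e. e \<in> G \<Longrightarrow> finite e \<and> card e = r"
  shows "(\<Sum>x\<in>X. card {e\<in>G. x \<in> e}) \<le> r * card G"
proof -
  have "(\<Sum>e\<in>G. card (e \<inter> X)) \<le> (\<Sum>e\<in>G. r)"
    using assms(3) by (intro sum_mono) (metis card_mono inf_le1)
  then show ?thesis
    using sum_degrees[OF assms(1,2)] by (simp add: mult.commute)
qed

lemma card_meeting_le_sum_degrees: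
  assumes "finite X" "finite G"
  shows "card {e\<in>G. e \<inter> X \<noteq> {}} \<le> (\<Sum>x\<in>X. card {e\<in>G. x \<in> e})"
proof -
  have "{e\<in>G. e \<inter> X \<noteq> {}} = (\<Union>x\<in>X. {e\<in>G. x \<in> e})" by auto
  then show ?thesis using card_UN_le[OF assms(1)] by metis
qed

section \<open>The lopsided local lemma for random permutations\<close>

text \<open>Inductive bound 2/q on a conditional probability, with cardinalities in place of
  quotients so that no division by an empty event occurs. \<open>S\<close> splits into neighbours
  and non-neighbours of \<open>i\<close>. Given the non-neighbours alone, \<open>lop\<close> bounds
  the event by 1/q; restoring the neighbours at most halves the surviving set, as at most d of them
  each remove a share 2/q and 2 d/q \<le> 1/2. Independence is replaced by the one-sided condition
  \<open>lop\<close>.\<close>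

lemma lopsided_local_lemma_step:
  fixes A :: "'i \<Rightarrow> 'w set"
  assumes "finite \<Omega>" "finite I" "1 \<le> d" "4 * d \<le> q"
    and nb: "\<And>i. i \<in> I \<Longrightarrow> card {j\<in>I. nbr i j} \<le> d"
    and lop: "\<And>i S. \<lbrakk>i \<in> I; S \<subseteq> I; \<And>j. j \<in> S \<Longrightarrow> \<not> nbr i j\<rbrakk>
      \<Longrightarrow> q * card (A i \<inter> (\<Omega> - (\<Union>j\<in>S. A j))) \<le> card (\<Omega> - (\<Union>j\<in>S. A j))"
  shows "\<lbrakk>S \<subseteq> I; i \<in> I\<rbrakk>
    \<Longrightarrow> q * card (A i \<inter> (\<Omega> - (\<Union>j\<in>S. A j))) \<le> 2 * card (\<Omega> - (\<Union>j\<in>S. A j))"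
proof (induction "card S" arbitrary: S i rule: less_induct)
  case less
  define good where "good S = \<Omega> - (\<Union>j\<in>S. A j)" for S
  have finS: "finite S" using less.prems(1) assms(2) finite_subset by blast
  have fing: "finite (good T)" for T unfolding good_def using assms(1) by blast
  define S1 where "S1 = {j\<in>S. nbr i j}"
  define S2 where "S2 = {j\<in>S. \<not> nbr i j}"
  have S2I: "S2 \<subseteq> I" using less.prems S2_def by auto
  have sub: "good S \<subseteq> good S2" unfolding good_def S2_def by auto
  have l2: "q * card (A i \<inter> good S2) \<le> card (good S2)"
    unfolding good_def using lop[OF less.prems(2) S2I] S2_def by blast
  have "card (A i \<inter> good S) \<le> card (A i \<inter> good S2)"
    using sub fing by (intro card_mono) auto
  then have le: "q * card (A i \<inter> good S) \<le> card (good S2)"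
    using l2 by (meson le_trans mult_le_mono2)
  have "card (good S2) \<le> 2 * card (good S)"
  proof (cases "S1 = {}")
    case True
    then have "S2 = S" unfolding S1_def S2_def by auto
    then show ?thesis by simp
  next
    case False
    then have "S2 \<subset> S" unfolding S1_def S2_def by auto
    then have lt: "card S2 < card S" using finS by (simp add: psubset_card_mono)
    have each: "q * card (A j \<inter> good S2) \<le> 2 * card (good S2)" if "j \<in> S1" for j
      unfolding good_def using less.hyps[OF lt S2I] that less.prems(1) S1_def by blast
    have finS1: "finite S1" using finS S1_def by auto
    have cS1: "card S1 \<le> d"
    proof -
      have "card S1 \<le> card {j\<in>I. nbr i j}"
        using less.prems(1) assms(2) unfolding S1_def by (intro card_mono) auto
      then show ?thesis using nb[OF less.prems(2)] by simp
    qed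
    have "good S2 \<subseteq> good S \<union> (\<Union>j\<in>S1. A j \<inter> good S2)"
      unfolding good_def S1_def S2_def by auto
    then have "card (good S2) \<le> card (good S \<union> (\<Union>j\<in>S1. A j \<inter> good S2))"
      using fing finS1 by (intro card_mono) auto
    also have "\<dots> \<le> card (good S) + card (\<Union>j\<in>S1. A j \<inter> good S2)" by (rule card_Un_le)
    also have "\<dots> \<le> card (good S) + (\<Sum>j\<in>S1. card (A j \<inter> good S2))"
      by (intro add_left_mono card_UN_le finS1)
    finally have "q * card (good S2) \<le> q * card (good S) + (\<Sum>j\<in>S1. q * card (A j \<inter> good S2))"
      by (metis add_mult_distrib2 mult_le_mono2 sum_distrib_left)
    also have "\<dots> \<le> q * card (good S) + card S1 * (2 * card (good S2))"
      using sum_bounded_above[of S1 "\<lambda>j. q * card (A j \<inter> good S2)" "2 * card (good S2)"] each by auto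
    also have "\<dots> \<le> q * card (good S) + d * (2 * card (good S2))"
      using cS1 by simp
    finally have "2 * (q * card (good S2)) \<le> 2 * (q * card (good S)) + 4 * d * card (good S2)" by simp
    also have "\<dots> \<le> 2 * (q * card (good S)) + q * card (good S2)"
      using assms(4) by (meson add_le_mono le_refl mult_le_mono1)
    finally have "q * card (good S2) \<le> q * (2 * card (good S))" by simp
    then show ?thesis using assms(3,4) by auto
  qed
  then show ?case using le unfolding good_def by linarith
qed

text \<open>Events are avoided one at a time: each removes at most a share 2/q < 1 of the outcomes
  that survive, so the surviving set never becomes empty.\<close>

lemma lopsided_local_lemma:
  fixes A :: "'i \<Rightarrow> 'w set"
  assumes "finite \<Omega>" "\<Omega> \<noteq> {}" "finite I" "1 \<le> d" "4 * d \<le> q"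
    and nb: "\<And>i. i \<in> I \<Longrightarrow> card {j\<in>I. nbr i j} \<le> d"
    and lop: "\<And>i S. \<lbrakk>i \<in> I; S \<subseteq> I; \<And>j. j \<in> S \<Longrightarrow> \<not> nbr i j\<rbrakk>
      \<Longrightarrow> q * card (A i \<inter> (\<Omega> - (\<Union>j\<in>S. A j))) \<le> card (\<Omega> - (\<Union>j\<in>S. A j))"
  shows "\<Omega> - (\<Union>j\<in>I. A j) \<noteq> {}"
proof -
  have "\<Omega> - (\<Union>j\<in>S. A j) \<noteq> {}" if "S \<subseteq> I" for S
    using finite_subset[OF that assms(3)] that
  proof (induction S rule: finite_induct)
    case empty
    then show ?case using assms(2) by simp
  next
    case (insert i S)
    let ?g = "\<Omega> - (\<Union>j\<in>S. A j)"
    have pos: "0 < card ?g" using insert assms(1) by (simp add: card_gt_0_iff)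
    have "q * card (A i \<inter> ?g) \<le> 2 * card ?g"
      by (rule lopsided_local_lemma_step[where nbr = nbr and I = I and d = d])
        (use assms insert.prems in auto)
    moreover have "2 * card ?g < q * card ?g" using pos assms(4,5) by simp
    ultimately have "q * card (A i \<inter> ?g) < q * card ?g" by linarith
    then have "A i \<inter> ?g \<noteq> ?g" by auto
    then show ?case by auto
  qed
  then show ?thesis by blast
qed

section \<open>Negative dependency of random permutations\<close>

text \<open>\<open>\<tau>\<close> is an involution that swaps f - f2 with f2 - f. By the last two
  conclusions a point outside f either stays or enters f, which protects conditions on target sets
  disjoint from f.\<close>

lemma exists_exchange_permutation:
  assumes "finite f" "finite f2" "card f = card f2" "f \<subseteq> Y" "f2 \<subseteq> Y"
  obtains \<tau> where "\<tau> permutes Y" "\<tau> ` f = f2" "\<And>x. x \<notin> f \<Longrightarrow> x \<in> f2 \<Longrightarrow> \<tau> x \<in> f"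
    "\<And>x. x \<notin> f \<Longrightarrow> x \<notin> f2 \<Longrightarrow> \<tau> x = x"
proof -
  have "card (f - f2) = card (f2 - f)"
    using assms by (simp add: card_Diff_subset_Int Int_commute)
  then obtain h where h: "bij_betw h (f - f2) (f2 - f)"
    using assms by (meson finite_Diff finite_same_card_bij)
  let ?k = "the_inv_into (f - f2) h"
  have k: "bij_betw ?k (f2 - f) (f - f2)" using h by (rule bij_betw_the_inv_into)
  have kh: "?k (h x) = x" if "x \<in> f - f2" for x
    using h that by (meson bij_betw_imp_inj_on the_inv_into_f_f)
  have hk: "h (?k x) = x" if "x \<in> f2 - f" for x
    using h that f_the_inv_into_f[of h "f - f2" x] unfolding bij_betw_def by blast
  have hin: "h x \<in> f2 - f" if "x \<in> f - f2" for x using h that by (auto simp: bij_betw_def)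
  have kin: "?k x \<in> f - f2" if "x \<in> f2 - f" for x using k that by (auto simp: bij_betw_def)
  define \<tau> where "\<tau> x = (if x \<in> f - f2 then h x else if x \<in> f2 - f then ?k x else x)" for x
  have inv: "\<tau> (\<tau> x) = x" for x
    unfolding \<tau>_def using hin kin kh hk by auto
  have "\<tau> permutes Y"
    unfolding permutes_def
  proof (intro conjI allI impI)
    show "\<tau> x = x" if "x \<notin> Y" for x using that assms unfolding \<tau>_def by auto
    show "\<exists>!x. \<tau> x = y" for y using inv by metis
  qed
  moreover have "\<tau> ` f = f2"
  proof
    show "\<tau> ` f \<subseteq> f2" unfolding \<tau>_def using hin by auto
    have "\<tau> x \<in> f" if "x \<in> f2" for x using that kin unfolding \<tau>_def by auto
    then show "f2 \<subseteq> \<tau> ` f" using inv by (metis image_eqI subsetI)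
  qed
  moreover have "\<tau> x \<in> f" if "x \<notin> f" "x \<in> f2" for x using that kin unfolding \<tau>_def by auto
  moreover have "\<tau> x = x" if "x \<notin> f" "x \<notin> f2" for x using that unfolding \<tau>_def by auto
  ultimately show ?thesis using that by blast
qed

text \<open>Among the permutations that avoid the pairs in \<open>B\<close>, no target is less
  likely for the image of e than f: composing with an exchange permutation injects those taking e to
  f into those taking e to any other r-set. Summing over all targets gives a share of at most 1/C(N,
  r), the lopsided condition of the local lemma.\<close>

lemma permutations_negative_dependency:
  assumes "finite Y" "e \<subseteq> Y" "card e = r" "f \<subseteq> Y" "card f = r"
    and disj: "\<And>e' f'. (e', f') \<in> B \<Longrightarrow> e' \<inter> e = {} \<and> f' \<inter> f = {}"
  defines "S \<equiv> {\<pi>. \<pi> permutes Y \<and> (\<forall>(e', f')\<in>B. \<pi> ` e' \<noteq> f')}"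
  shows "(card Y choose r) * card {\<pi>\<in>S. \<pi> ` e = f} \<le> card S"
proof -
  have finS: "finite S" unfolding S_def using finite_permutations[OF assms(1)] by simp
  let ?R = "{f2. f2 \<subseteq> Y \<and> card f2 = r}"
  have le: "card {\<pi>\<in>S. \<pi> ` e = f} \<le> card {\<pi>\<in>S. \<pi> ` e = f2}" if f2: "f2 \<in> ?R" for f2
  proof -
    have "finite f" "finite f2" using assms f2 finite_subset by auto
    then obtain \<tau> where \<tau>: "\<tau> permutes Y" "\<tau> ` f = f2" "\<And>x. x \<notin> f \<Longrightarrow> x \<in> f2 \<Longrightarrow> \<tau> x \<in> f"
      "\<And>x. x \<notin> f \<Longrightarrow> x \<notin> f2 \<Longrightarrow> \<tau> x = x"
      using exists_exchange_permutation[of f f2 Y] assms f2 by auto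
    have "inj_on (\<lambda>\<pi>. \<tau> \<circ> \<pi>) {\<pi>\<in>S. \<pi> ` e = f}"
      by (rule inj_onI) (use permutes_inj[OF \<tau>(1)] in \<open>auto simp: fun_eq_iff inj_eq\<close>)
    moreover have "(\<lambda>\<pi>. \<tau> \<circ> \<pi>) ` {\<pi>\<in>S. \<pi> ` e = f} \<subseteq> {\<pi>\<in>S. \<pi> ` e = f2}"
    proof (rule image_subsetI)
      fix \<pi> assume "\<pi> \<in> {\<pi>\<in>S. \<pi> ` e = f}"
      then have \<pi>: "\<pi> permutes Y" "\<And>e' f'. (e', f') \<in> B \<Longrightarrow> \<pi> ` e' \<noteq> f'" "\<pi> ` e = f"
        unfolding S_def by auto
      have "(\<tau> \<circ> \<pi>) ` e' \<noteq> f'" if B: "(e', f') \<in> B" for e' f'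
      proof
        assume eq: "(\<tau> \<circ> \<pi>) ` e' = f'"
        \<comment> \<open>The image of x lies outside f because e' misses e. If
          \<open>\<tau>\<close> moved it, it would land in f, but f' misses f. So a forbidden pair
          that occurs after \<open>\<tau>\<close> occurred before.\<close>
        have "\<tau> (\<pi> x) = \<pi> x" if "x \<in> e'" for x
        proof -
          have "\<pi> x \<notin> \<pi> ` e"
            using disj[OF B] that permutes_inj[OF \<pi>(1)] by (auto simp: inj_image_mem_iff)
          then have "\<pi> x \<notin> f" using \<pi>(3) by simp
          moreover have "\<tau> (\<pi> x) \<notin> f" using disj[OF B] eq that by auto
          ultimately show ?thesis using \<tau>(3,4)[of "\<pi> x"] by blast
        qed
        then have "\<pi> ` e' = f'" using eq by force
        then show False using \<pi>(2) B by blast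
      qed
      moreover have "(\<tau> \<circ> \<pi>) ` e = f2" using \<pi>(3) \<tau>(2) by (simp only: image_comp[symmetric])
      moreover have "\<tau> \<circ> \<pi> permutes Y" using \<pi>(1) \<tau>(1) permutes_compose by blast
      ultimately show "\<tau> \<circ> \<pi> \<in> {\<pi>\<in>S. \<pi> ` e = f2}" unfolding S_def by auto
    qed
    ultimately show ?thesis using finS by (intro card_inj_on_le) auto
  qed
  have finR: "finite ?R" using assms(1) by simp
  have "(card Y choose r) * card {\<pi>\<in>S. \<pi> ` e = f} = (\<Sum>f2\<in>?R. card {\<pi>\<in>S. \<pi> ` e = f})"
    using n_subsets[OF assms(1)] by simp
  also have "\<dots> \<le> (\<Sum>f2\<in>?R. card {\<pi>\<in>S. \<pi> ` e = f2})" using le by (rule sum_mono)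
  also have "\<dots> = card (\<Union>f2\<in>?R. {\<pi>\<in>S. \<pi> ` e = f2})"
    using finS finR by (subst card_UN_disjoint) auto
  also have "\<dots> \<le> card S" using finS by (intro card_mono) auto
  finally show ?thesis .
qed

text \<open>The bad events say that some e is mapped onto some f. Pairs are neighbours if they share
  a vertex on either side, so a pair has at most r \<Delta> |F| + r d |E| neighbours. Double
  counting, r |F| \<le> N d and r |E| \<le> N \<Delta>, turns this into 2 N \<Delta> d, and the
  factor 4 of the local lemma makes the 8.\<close>

lemma exists_permutation_avoiding:
  fixes Y :: "'a set"
  assumes "finite Y"
    and E: "\<And>e. e \<in> E \<Longrightarrow> e \<subseteq> Y \<and> card e = r" and F: "\<And>f. f \<in> F \<Longrightarrow> f \<subseteq> Y \<and> card f = r"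
    and dE: "\<And>y. y \<in> Y \<Longrightarrow> card {e\<in>E. y \<in> e} \<le> \<Delta>"
    and dF: "\<And>y. y \<in> Y \<Longrightarrow> card {f\<in>F. y \<in> f} \<le> d"
    and "1 \<le> r" and bound: "8 * card Y * \<Delta> * d \<le> (card Y choose r)"
  obtains \<pi> where "\<pi> permutes Y" "\<And>e. e \<in> E \<Longrightarrow> \<pi> ` e \<notin> F"
proof (cases "E = {} \<or> F = {}")
  case True
  then show ?thesis using that[of id] permutes_id by auto
next
  case False
  then obtain e0 f0 where e0: "e0 \<in> E" and f0: "f0 \<in> F" by auto
  have finE: "finite E" and finF: "finite F"
    using finite_subset[of _ "Pow Y"] E F assms(1) by blast+
  have "e0 \<noteq> {}" "f0 \<noteq> {}" using E[OF e0] F[OF f0] assms(6) by auto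
  then obtain y0 y1 where y0: "y0 \<in> e0" "y0 \<in> Y" and y1: "y1 \<in> f0" "y1 \<in> Y"
    using E[OF e0] F[OF f0] by blast
  have "{e\<in>E. y0 \<in> e} \<noteq> {}" "{f\<in>F. y1 \<in> f} \<noteq> {}" using e0 f0 y0 y1 by auto
  then have "0 < card {e\<in>E. y0 \<in> e}" "0 < card {f\<in>F. y1 \<in> f}"
    using finite_subset[OF _ finE] finite_subset[OF _ finF] by (simp_all only: card_gt_0_iff) auto
  \<comment> \<open>The local lemma asks for a positive number of neighbours, hence the separate
    treatment of empty families.\<close>
  then have "\<Delta> \<ge> 1" "d \<ge> 1" using dE[OF y0(2)] dF[OF y1(2)] by linarith+
  let ?N = "card Y"
  have N1: "?N \<ge> 1" using y0(2) assms(1) card_gt_0_iff[of Y] by (metis One_nat_def Suc_leI empty_iff)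
  have rE: "r * card E \<le> ?N * \<Delta>"
    using sum_degrees_uniform[OF assms(1) finE E] sum_bounded_above[of Y "\<lambda>y. card {e\<in>E. y \<in> e}" \<Delta>] dE by simp
  have rF: "r * card F \<le> ?N * d"
    using sum_degrees_uniform[OF assms(1) finF F] sum_bounded_above[of Y "\<lambda>y. card {e\<in>F. y \<in> e}" d] dF by simp
  define nbr where "nbr p p' \<longleftrightarrow> fst p' \<inter> fst p \<noteq> {} \<or> snd p' \<inter> snd p \<noteq> {}" for p p' :: "'a set \<times> 'a set"
  define A where "A p = {\<pi>. \<pi> permutes Y \<and> \<pi> ` fst p = snd p}" for p :: "'a set \<times> 'a set"
  let ?\<Omega> = "{\<pi>. \<pi> permutes Y}"
  have meet: "card {e'\<in>G. e' \<inter> e \<noteq> {}} \<le> r * k"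
    if "finite G" "e \<subseteq> Y" "card e = r" "\<And>y. y \<in> Y \<Longrightarrow> card {e\<in>G. y \<in> e} \<le> k" for e G k
  proof -
    have "card {e'\<in>G. e' \<inter> e \<noteq> {}} \<le> (\<Sum>x\<in>e. card {e'\<in>G. x \<in> e'})"
      using that assms(1) finite_subset by (intro card_meeting_le_sum_degrees) auto
    also have "\<dots> \<le> card e * k"
      using sum_bounded_above[of e "\<lambda>y. card {e\<in>G. y \<in> e}" k] that by auto
    finally show ?thesis using that by simp
  qed
  have "?\<Omega> - (\<Union>p\<in>E \<times> F. A p) \<noteq> {}"
  proof (rule lopsided_local_lemma[where d = "2 * ?N * \<Delta> * d" and q = "?N choose r" and nbr = nbr])
    show "finite ?\<Omega>" using finite_permutations[OF assms(1)] .
    show "?\<Omega> \<noteq> {}" using permutes_id by blast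
    show "finite (E \<times> F)" using finE finF by simp
    show "1 \<le> 2 * ?N * \<Delta> * d" using N1 \<open>\<Delta> \<ge> 1\<close> \<open>d \<ge> 1\<close> by (simp add: Suc_leI)
    show "4 * (2 * ?N * \<Delta> * d) \<le> (?N choose r)" using bound by simp
    show "card {j\<in>E \<times> F. nbr i j} \<le> 2 * ?N * \<Delta> * d" if iEF: "i \<in> E \<times> F" for i
    proof -
      obtain e f where i: "i = (e, f)" "e \<in> E" "f \<in> F" using iEF by auto
      have "{j\<in>E \<times> F. nbr i j} \<subseteq> {e'\<in>E. e' \<inter> e \<noteq> {}} \<times> F \<union> E \<times> {f'\<in>F. f' \<inter> f \<noteq> {}}"
        unfolding nbr_def i by auto
      then have "card {j\<in>E \<times> F. nbr i j}
          \<le> card ({e'\<in>E. e' \<inter> e \<noteq> {}} \<times> F \<union> E \<times> {f'\<in>F. f' \<inter> f \<noteq> {}})"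
        using finE finF by (intro card_mono) auto
      also have "\<dots> \<le> card {e'\<in>E. e' \<inter> e \<noteq> {}} * card F + card E * card {f'\<in>F. f' \<inter> f \<noteq> {}}"
        using card_Un_le[of "{e'\<in>E. e' \<inter> e \<noteq> {}} \<times> F" "E \<times> {f'\<in>F. f' \<inter> f \<noteq> {}}"]
        by (simp only: card_cartesian_product)
      also have "\<dots> \<le> (r * \<Delta>) * card F + card E * (r * d)"
        using meet[OF finE _ _ dE, of e] meet[OF finF _ _ dF, of f] E[OF i(2)] F[OF i(3)]
        by (intro add_le_mono mult_le_mono) auto
      also have "\<dots> = \<Delta> * (r * card F) + d * (r * card E)" by (simp add: algebra_simps)
      also have "\<dots> \<le> \<Delta> * (?N * d) + d * (?N * \<Delta>)"
        using rE rF by (intro add_le_mono mult_le_mono2)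
      finally show ?thesis by (simp add: algebra_simps)
    qed
    show "(?N choose r) * card (A i \<inter> (?\<Omega> - (\<Union>j\<in>S. A j))) \<le> card (?\<Omega> - (\<Union>j\<in>S. A j))"
      if iEF: "i \<in> E \<times> F" and "S \<subseteq> E \<times> F" "\<And>j. j \<in> S \<Longrightarrow> \<not> nbr i j" for i S
    proof -
      obtain e f where i: "i = (e, f)" "e \<in> E" "f \<in> F" using iEF by auto
      have eq: "?\<Omega> - (\<Union>j\<in>S. A j) = {\<pi>. \<pi> permutes Y \<and> (\<forall>(e', f')\<in>S. \<pi> ` e' \<noteq> f')}"
        unfolding A_def by auto
      have eq2: "A i \<inter> (?\<Omega> - (\<Union>j\<in>S. A j)) = {\<pi>\<in>?\<Omega> - (\<Union>j\<in>S. A j). \<pi> ` e = f}"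
        unfolding A_def i by auto
      have "e' \<inter> e = {} \<and> f' \<inter> f = {}" if "(e', f') \<in> S" for e' f'
        using \<open>\<And>j. j \<in> S \<Longrightarrow> \<not> nbr i j\<close>[OF that] unfolding nbr_def i by simp
      then show ?thesis
        unfolding eq2 unfolding eq
        using permutations_negative_dependency[of Y e r f S] assms(1) E[OF i(2)] F[OF i(3)] by blast
    qed
  qed
  then obtain \<pi> where "\<pi> \<in> ?\<Omega>" "\<pi> \<notin> (\<Union>p\<in>E \<times> F. A p)" by blast
  then have "\<pi> permutes Y" "\<pi> ` e \<notin> F" if "e \<in> E" for e
    using that unfolding A_def by auto
  then show ?thesis using that e0 by blast
qed

section \<open>Families of disjoint copies\<close>

text \<open>Only the vertex set of a copy is kept: the argument counts vertices, and disjoint copies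
  become disjoint members of a set of sets.\<close>

definition copy_on :: "('b set \<times> 'b set set) \<Rightarrow> 'a set set \<Rightarrow> 'a set \<Rightarrow> bool" where
  "copy_on B E S \<longleftrightarrow> (\<exists>g. bij_betw g (fst B) S \<and> (\<forall>e\<in>snd B. g ` e \<in> E))"

lemma copy_on_mono: "copy_on B E S \<Longrightarrow> E \<subseteq> E' \<Longrightarrow> copy_on B E' S"
  unfolding copy_on_def by blast

lemma card_copy_on: "copy_on B E S \<Longrightarrow> card S = card (fst B)"
  unfolding copy_on_def by (auto dest: bij_betw_same_card)

lemma finite_copy_on: "copy_on B E S \<Longrightarrow> finite (fst B) \<Longrightarrow> finite S"
  unfolding copy_on_def by (auto dest: bij_betw_finite)

definition packing :: "('b set \<times> 'b set set) \<Rightarrow> 'a set set \<Rightarrow> 'a set set \<Rightarrow> bool" where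
  "packing B E \<S> \<longleftrightarrow> finite \<S> \<and> disjoint \<S> \<and> (\<forall>S\<in>\<S>. copy_on B E S)"

lemma packing_empty: "packing B E {}"
  unfolding packing_def by simp

lemma packing_subset: "packing B E \<S> \<Longrightarrow> \<S>' \<subseteq> \<S> \<Longrightarrow> packing B E \<S>'"
  unfolding packing_def using finite_subset[of \<S>' \<S>] by (auto simp: disjoint_def)

lemma packing_mono: "packing B E \<S> \<Longrightarrow> E \<subseteq> E' \<Longrightarrow> packing B E' \<S>"
  unfolding packing_def by (auto intro: copy_on_mono)

lemma packing_Un:
  assumes "packing B E \<S>" "packing B E \<S>'" "\<Union>\<S> \<inter> \<Union>\<S>' = {}"
  shows "packing B E (\<S> \<union> \<S>')"
  using assms disjoint_union[of \<S> \<S>'] unfolding packing_def by auto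

lemma card_packing_Un:
  assumes "packing B E \<S>" "packing B E \<S>'" "\<Union>\<S> \<inter> \<Union>\<S>' = {}" "fst B \<noteq> {}"
  shows "card (\<S> \<union> \<S>') = card \<S> + card \<S>'"
proof -
  have "S \<noteq> {}" if "S \<in> \<S>" for S
    using assms(1,4) that unfolding packing_def copy_on_def bij_betw_def by auto
  then have "\<S> \<inter> \<S>' = {}" using assms(3) by auto
  then show ?thesis using assms unfolding packing_def by (simp add: card_Un_disjoint)
qed

lemma card_Union_packing:
  assumes "packing B E \<S>" "finite (fst B)"
  shows "card (\<Union>\<S>) = card (fst B) * card \<S>" "finite (\<Union>\<S>)"
proof -
  have f: "finite S" "card S = card (fst B)" if "S \<in> \<S>" for S
    using that assms finite_copy_on[of B E S] card_copy_on[of B E S] unfolding packing_def by simp_all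
  then have "card (\<Union>\<S>) = sum card \<S>"
    using assms unfolding packing_def by (intro card_Union_disjoint) (simp_all add: disjoint_def pairwise_def disjnt_def)
  then show "card (\<Union>\<S>) = card (fst B) * card \<S>" using f by simp
  show "finite (\<Union>\<S>)" using f assms unfolding packing_def by auto
qed

text \<open>Trades maps on indexed vertices for sets of vertex sets, the form used from here on. A
  nonempty \<open>fst B\<close> keeps the k images distinct as sets.\<close>

lemma contains_copies_iff_packing:
  assumes "fst B \<noteq> {}" and sub: "\<And>e. e \<in> snd B \<Longrightarrow> e \<subseteq> fst B"
  shows "contains (V, E) (copies k B) \<longleftrightarrow> (\<exists>\<S>. packing B E \<S> \<and> card \<S> = k \<and> \<Union>\<S> \<subseteq> V)"
proof
  assume "contains (V, E) (copies k B)"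
  then obtain f where f: "inj_on f (fst (copies k B))" "f ` fst (copies k B) \<subseteq> V"
    "\<forall>e\<in>snd (copies k B). f ` e \<in> E"
    unfolding contains_def by auto
  have inj: "inj_on f ({..<k} \<times> fst B)" and im: "f ` ({..<k} \<times> fst B) \<subseteq> V"
    using f unfolding copies_def by auto
  have ed: "f ` (\<lambda>x. (i, x)) ` e \<in> E" if "i < k" "e \<in> snd B" for i e
  proof -
    have "(\<lambda>x. (i, x)) ` e \<in> snd (copies k B)" unfolding copies_def using that by auto
    then show ?thesis using f(3) by blast
  qed
  define S where "S i = f ` ({i} \<times> fst B)" for i
  have disj: "S i \<inter> S j = {}" if "i < k" "j < k" "i \<noteq> j" for i j
    using inj that unfolding S_def inj_on_def by auto
  have ne: "S i \<noteq> {}" for i unfolding S_def using assms by auto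
  have cp: "copy_on B E (S i)" if "i < k" for i
    unfolding copy_on_def
  proof (intro exI conjI ballI)
    show "bij_betw (\<lambda>x. f (i, x)) (fst B) (S i)"
      using inj that unfolding S_def bij_betw_def inj_on_def by auto
    show "(\<lambda>x. f (i, x)) ` e \<in> E" if "e \<in> snd B" for e
      using ed[OF \<open>i < k\<close> that] by (simp add: image_comp o_def)
  qed
  have "inj_on S {..<k}" using disj ne unfolding inj_on_def by (metis inf.idem lessThan_iff)
  then have "card (S ` {..<k}) = k" by (simp add: card_image)
  moreover have "packing B E (S ` {..<k})"
    unfolding packing_def disjoint_def using disj cp by blast
  moreover have "\<Union>(S ` {..<k}) \<subseteq> V" using im unfolding S_def by auto
  ultimately show "\<exists>\<S>. packing B E \<S> \<and> card \<S> = k \<and> \<Union>\<S> \<subseteq> V" by blast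
next
  assume "\<exists>\<S>. packing B E \<S> \<and> card \<S> = k \<and> \<Union>\<S> \<subseteq> V"
  then obtain \<S> where pk: "packing B E \<S>" "card \<S> = k" "\<Union>\<S> \<subseteq> V" by blast
  then obtain S where S: "bij_betw S {..<k} \<S>"
    unfolding packing_def by (metis atLeast0LessThan ex_bij_betw_nat_finite)
  then have Sin: "S i \<in> \<S>" if "i < k" for i using that by (auto simp: bij_betw_def)
  have "\<exists>g. bij_betw g (fst B) (S i) \<and> (\<forall>e\<in>snd B. g ` e \<in> E)" if "i < k" for i
    using pk(1) Sin[OF that] unfolding packing_def copy_on_def by auto
  then obtain g where g: "\<And>i. i < k \<Longrightarrow> bij_betw (g i) (fst B) (S i)"
    "\<And>i e. i < k \<Longrightarrow> e \<in> snd B \<Longrightarrow> g i ` e \<in> E" by metis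
  define f where "f = (\<lambda>(i, x). g i x)"
  have "inj_on f ({..<k} \<times> fst B)"
  proof (rule inj_onI)
    fix a b assume ab: "a \<in> {..<k} \<times> fst B" "b \<in> {..<k} \<times> fst B" "f a = f b"
    obtain i x j y where ij: "a = (i, x)" "b = (j, y)" by fastforce
    have h: "i < k" "x \<in> fst B" "j < k" "y \<in> fst B" "f (i, x) = f (j, y)" using ab ij by auto
    then have "g i x \<in> S i" "g i x \<in> S j"
      using bij_betwE[OF g(1), of i] bij_betwE[OF g(1), of j] unfolding f_def by auto
    then have "S i = S j" using pk(1) Sin h unfolding packing_def disjoint_def by blast
    then have "i = j" using S h unfolding bij_betw_def inj_on_def by auto
    moreover have "x = y"
      using h \<open>i = j\<close> g(1)[OF h(1)] unfolding f_def bij_betw_def inj_on_def by auto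
    ultimately show "a = b" using ij by simp
  qed
  moreover have "f ` ({..<k} \<times> fst B) \<subseteq> V"
    using g(1) Sin pk(3) unfolding f_def bij_betw_def by fastforce
  moreover have "f ` (\<lambda>x. (i, x)) ` e \<in> E" if "i < k" "e \<in> snd B" for i e
    using g(2)[OF that] by (simp add: image_comp o_def f_def)
  ultimately show "contains (V, E) (copies k B)"
    unfolding contains_def copies_def by auto
qed

text \<open>Place k disjoint copies of \<open>B\<close> on \<open>R\<close> arbitrarily, then
  permute \<open>R\<close> so that no edge of the placement lands on a missing edge. A vertex lies
  in at most one placed copy, so the placement has degrees at most \<open>card (snd B)\<close>
  whatever k is; the copies may cover all of \<open>R\<close>.\<close>

lemma packing_in_almost_complete:
  assumes "finite R" "1 \<le> r" "finite (fst B)" "fst B \<noteq> {}" "finite (snd B)"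
    and B: "\<And>e. e \<in> snd B \<Longrightarrow> e \<subseteq> fst B \<and> card e = r"
    and miss: "\<And>v. v \<in> R \<Longrightarrow> card {f. f \<subseteq> R \<and> card f = r \<and> f \<notin> E \<and> v \<in> f} \<le> d"
    and bound: "8 * card R * card (snd B) * d \<le> (card R choose r)"
    and k: "card (fst B) * k \<le> card R"
  obtains \<S> where "packing B E \<S>" "card \<S> = k" "\<Union>\<S> \<subseteq> R"
proof -
  have "card ({..<k} \<times> fst B) \<le> card R" using k by (simp add: mult.commute card_cartesian_product)
  then obtain g where g: "inj_on g ({..<k} \<times> fst B)" "g ` ({..<k} \<times> fst B) \<subseteq> R"
    using assms(1,3) by (metis card_le_inj finite_SigmaI finite_lessThan)
  define \<E> where "\<E> = {g ` Pair i ` e | i e. i < k \<and> e \<in> snd B}"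
  define F where "F = {f. f \<subseteq> R \<and> card f = r \<and> f \<notin> E}"
  have \<E>: "e \<subseteq> R \<and> card e = r" if "e \<in> \<E>" for e
  proof -
    obtain i e' where e': "e = g ` Pair i ` e'" "i < k" "e' \<in> snd B" using \<open>e \<in> \<E>\<close> \<E>_def by auto
    then have sub: "Pair i ` e' \<subseteq> {..<k} \<times> fst B" using B by auto
    have "card e = card (Pair i ` e')" unfolding e' using g(1) sub by (meson card_image inj_on_subset)
    also have "\<dots> = card e'" by (simp add: card_image inj_on_def)
    finally show ?thesis using B e' g(2) sub by blast
  qed
  have deg: "card {e\<in>\<E>. y \<in> e} \<le> card (snd B)" for y
  proof (cases "\<exists>i x. i < k \<and> x \<in> fst B \<and> y = g (i, x)")
    case True
    then obtain i x where ix: "i < k" "x \<in> fst B" "y = g (i, x)" by blast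
    have "{e\<in>\<E>. y \<in> e} \<subseteq> (\<lambda>e. g ` Pair i ` e) ` snd B"
    proof
      fix e assume "e \<in> {e\<in>\<E>. y \<in> e}"
      then obtain j e' x' where h: "e = g ` Pair j ` e'" "j < k" "e' \<in> snd B" "x' \<in> e'" "y = g (j, x')"
        unfolding \<E>_def by auto
      then have "(j, x') = (i, x)" using g(1) ix B[OF h(3)] unfolding inj_on_def by auto
      then show "e \<in> (\<lambda>e. g ` Pair i ` e) ` snd B" using h by blast
    qed
    then show ?thesis using assms(5) by (rule surj_card_le[rotated])
  next
    case False
    then have "{e\<in>\<E>. y \<in> e} = {}" unfolding \<E>_def using B by blast
    then show ?thesis by (simp only: card.empty)
  qed
  have F1: "f \<subseteq> R \<and> card f = r" if "f \<in> F" for f using that unfolding F_def by blast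
  have F2: "card {f\<in>F. y \<in> f} \<le> d" if "y \<in> R" for y
  proof -
    have "{f\<in>F. y \<in> f} = {f. f \<subseteq> R \<and> card f = r \<and> f \<notin> E \<and> y \<in> f}" unfolding F_def by blast
    then show ?thesis using miss[OF that] by simp
  qed
  obtain \<pi> where \<pi>: "\<pi> permutes R" "\<And>e. e \<in> \<E> \<Longrightarrow> \<pi> ` e \<notin> F"
    using exists_permutation_avoiding[OF assms(1) \<E> F1 deg F2 assms(2) bound] by blast
  have "contains (R, E) (copies k B)"
    unfolding contains_def
  proof (intro exI conjI ballI)
    show "inj_on (\<pi> \<circ> g) (fst (copies k B))"
      unfolding copies_def using g(1) permutes_inj_on[OF \<pi>(1)] by (simp add: comp_inj_on)
    show "(\<pi> \<circ> g) ` fst (copies k B) \<subseteq> fst (R, E)"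
      unfolding copies_def using g(2) permutes_in_image[OF \<pi>(1)] by auto
    show "(\<pi> \<circ> g) ` e \<in> snd (R, E)" if "e \<in> snd (copies k B)" for e
    proof -
      have e: "g ` e \<in> \<E>" using that unfolding copies_def \<E>_def by auto
      have "\<pi> ` g ` e \<subseteq> R" using \<E>[OF e] permutes_in_image[OF \<pi>(1)] by auto
      moreover have "card (\<pi> ` g ` e) = r"
        using \<E>[OF e] card_image[OF permutes_inj_on[OF \<pi>(1)]] by metis
      ultimately show ?thesis using \<pi>(2)[OF e] unfolding F_def by (simp add: image_comp)
    qed
  qed
  then show ?thesis
    using that contains_copies_iff_packing[of B R E k] assms(4) B by blast
qed

section \<open>Boxes in dense sets of tuples\<close>

text \<open>The theorem of Erdos for ordered tuples. Fix K first coordinates with dense sets of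
  tails. By averaging, many tails are extended by at least T of these; by pigeonhole, a positive
  share of the tails has the same set of admissible first coordinates, and the induction hypothesis
  applies to those tails.\<close>

lemma dense_set_of_lists_contains_box:
  fixes \<epsilon> :: real
  assumes "\<epsilon> > 0"
  shows "\<exists>n0. \<forall>(V :: 'a set) A. finite V \<longrightarrow> n0 \<le> card V \<longrightarrow> A \<subseteq> {xs. set xs \<subseteq> V \<and> length xs = r}
    \<longrightarrow> \<epsilon> * real (card V) ^ r \<le> real (card A)
    \<longrightarrow> (\<exists>Ss. length Ss = r \<and> (\<forall>S\<in>set Ss. S \<subseteq> V \<and> card S = T) \<and> {xs. list_all2 (\<in>) xs Ss} \<subseteq> A)"
  using assms
proof (induction r arbitrary: \<epsilon>)
  case 0
  have "\<exists>Ss. length Ss = 0 \<and> (\<forall>S\<in>set Ss. S \<subseteq> V \<and> card S = T) \<and> {xs. list_all2 (\<in>) xs Ss} \<subseteq> A"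
    if "A \<subseteq> {xs. set xs \<subseteq> V \<and> length xs = 0}" "\<epsilon> * real (card V) ^ 0 \<le> real (card A)" for V :: "'a set" and A
  proof -
    have "A \<noteq> {}" using that(2) 0 by auto
    then have "[] \<in> A" using that(1) by auto
    then show ?thesis by (intro exI[of _ "[]"]) auto
  qed
  then show ?case by blast
next
  case (Suc r)
  \<comment> \<open>K first coordinates with tail density \<epsilon>/2 contribute at least K
    \<epsilon>/2 per tail on average. Tails with fewer than T extensions account for at most T \<le>
    K \<epsilon>/4 of this.\<close>
  define K where "K = nat \<lceil>4 * real T / \<epsilon>\<rceil> + 1"
  have K: "4 * real T \<le> \<epsilon> * real K" "K \<ge> 1"
  proof -
    have "4 * real T / \<epsilon> \<le> real K" unfolding K_def by linarith
    then show "4 * real T \<le> \<epsilon> * real K" using Suc.prems by (simp add: field_simps)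
  qed (simp add: K_def)
  \<comment> \<open>Good tails have density \<epsilon>/4 and are divided among the 2^K subsets of
    \<open>Q\<close>.\<close>
  define \<epsilon>' where "\<epsilon>' = \<epsilon> / 4 / 2 ^ K"
  have "\<epsilon>' > 0" unfolding \<epsilon>'_def using Suc.prems by simp
  from Suc.IH[OF this] obtain n0 where n0: "\<And>(V :: 'a set) A. finite V \<Longrightarrow> n0 \<le> card V
    \<Longrightarrow> A \<subseteq> {xs. set xs \<subseteq> V \<and> length xs = r} \<Longrightarrow> \<epsilon>' * real (card V) ^ r \<le> real (card A)
    \<Longrightarrow> \<exists>Ss. length Ss = r \<and> (\<forall>S\<in>set Ss. S \<subseteq> V \<and> card S = T) \<and> {xs. list_all2 (\<in>) xs Ss} \<subseteq> A"
    by blast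
  \<comment> \<open>The second term ensures that at least K first coordinates have dense sets of
    tails.\<close>
  define n1 where "n1 = max n0 (nat \<lceil>2 * real K / \<epsilon>\<rceil> + 1)"
  show ?case
  proof (rule exI[of _ n1], intro allI impI)
    fix V :: "'a set" and A
    assume V: "finite V" and n: "n1 \<le> card V" and A: "A \<subseteq> {xs. set xs \<subseteq> V \<and> length xs = Suc r}"
      and dens: "\<epsilon> * real (card V) ^ Suc r \<le> real (card A)"
    let ?n = "card V"
    have nn: "n0 \<le> ?n" "2 * real K \<le> \<epsilon> * real ?n" "?n \<ge> 1"
    proof -
      have "2 * real K / \<epsilon> \<le> real ?n" using n unfolding n1_def by linarith
      then show "2 * real K \<le> \<epsilon> * real ?n" using Suc.prems by (simp add: field_simps)
    qed (use n n1_def in auto)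
    define L where "L = {zs. set zs \<subseteq> V \<and> length zs = r}"
    have L: "finite L" "card L = ?n ^ r"
      unfolding L_def using finite_lists_length_eq[OF V] card_lists_length_eq[OF V] by auto
    define Au where "Au u = {zs\<in>L. u # zs \<in> A}" for u
    have finAu: "finite (Au u)" for u unfolding Au_def using L by simp
    have AuL: "card (Au u) \<le> ?n ^ r" for u using L card_mono[of L "Au u"] unfolding Au_def by auto
    have "A \<subseteq> (\<Union>u\<in>V. (#) u ` Au u)"
    proof
      fix xs assume "xs \<in> A"
      then obtain u zs where "xs = u # zs" "u \<in> V" "zs \<in> L" using A unfolding L_def
        by (cases xs) auto
      then show "xs \<in> (\<Union>u\<in>V. (#) u ` Au u)" using \<open>xs \<in> A\<close> unfolding Au_def by auto
    qed
    then have "card A \<le> card (\<Union>u\<in>V. (#) u ` Au u)" using V finAu by (intro card_mono) auto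
    also have "\<dots> \<le> (\<Sum>u\<in>V. card ((#) u ` Au u))" by (rule card_UN_le[OF V])
    also have "\<dots> \<le> (\<Sum>u\<in>V. card (Au u))" using card_image_le[OF finAu] by (intro sum_mono) auto
    finally have cA: "real (card A) \<le> (\<Sum>u\<in>V. real (card (Au u)))" by (metis of_nat_le_iff of_nat_sum)
    define Q0 where "Q0 = {u\<in>V. \<epsilon> / 2 * real ?n ^ r \<le> real (card (Au u))}"
    have Q0: "finite Q0" "Q0 \<subseteq> V" unfolding Q0_def using V by auto
    have "(\<Sum>u\<in>V. real (card (Au u))) = (\<Sum>u\<in>Q0. real (card (Au u))) + (\<Sum>u\<in>V-Q0. real (card (Au u)))"
      using V Q0 by (simp add: sum.subset_diff[OF Q0(2)] add.commute)
    also have "\<dots> \<le> real (card Q0) * real ?n ^ r + real (card (V - Q0)) * (\<epsilon> / 2 * real ?n ^ r)"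
      using AuL by (intro add_mono sum_bounded_above) (auto simp: Q0_def simp flip: of_nat_power)
    also have "\<dots> \<le> real (card Q0) * real ?n ^ r + real ?n * (\<epsilon> / 2 * real ?n ^ r)"
      using V Suc.prems by (intro add_left_mono mult_right_mono) (auto intro: card_mono)
    finally have "\<epsilon> * real ?n * real ?n ^ r \<le> (real (card Q0) + real ?n * (\<epsilon> / 2)) * real ?n ^ r"
      using cA dens by (simp add: algebra_simps)
    then have "\<epsilon> * real ?n \<le> real (card Q0) + real ?n * (\<epsilon> / 2)"
      using nn(3) by (simp add: mult_le_cancel_right)
    then have "real K \<le> real (card Q0)" using nn(2) by (simp add: algebra_simps)
    then obtain Q where Q: "Q \<subseteq> Q0" "card Q = K" "finite Q"
      using Q0(1) by (metis obtain_subset_with_card_n of_nat_le_iff)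
    define c where "c zs = {u\<in>Q. u # zs \<in> A}" for zs
    have cK: "card (c zs) \<le> K" for zs
      using card_mono[OF Q(3), of "c zs"] Q(2) unfolding c_def by auto
    have "(\<Sum>u\<in>Q. card (Au u)) = (\<Sum>u\<in>Q. \<Sum>zs\<in>L. if u # zs \<in> A then 1 else 0)"
      unfolding Au_def using L(1) by (intro sum.cong) (auto simp: sum.If_cases Int_def)
    also have "\<dots> = (\<Sum>zs\<in>L. \<Sum>u\<in>Q. if u # zs \<in> A then 1 else 0)" by (rule sum.swap)
    also have "\<dots> = (\<Sum>zs\<in>L. card (c zs))"
      unfolding c_def using Q(3) by (intro sum.cong) (auto simp: sum.If_cases Int_def)
    finally have sw: "(\<Sum>u\<in>Q. real (card (Au u))) = (\<Sum>zs\<in>L. real (card (c zs)))"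
      by (simp flip: of_nat_sum)
    define G where "G = {zs\<in>L. T \<le> card (c zs)}"
    have G: "finite G" "G \<subseteq> L" unfolding G_def using L by auto
    have "real K * (\<epsilon> / 2 * real ?n ^ r) \<le> (\<Sum>u\<in>Q. real (card (Au u)))"
      using sum_bounded_below[of Q "\<epsilon> / 2 * real ?n ^ r" "\<lambda>u. real (card (Au u))"] Q unfolding Q0_def by auto
    also have "\<dots> = (\<Sum>zs\<in>G. real (card (c zs))) + (\<Sum>zs\<in>L-G. real (card (c zs)))"
      unfolding sw using L G by (simp add: sum.subset_diff[OF G(2)] add.commute)
    also have "\<dots> \<le> real (card G) * real K + real (card (L - G)) * real T"
      using cK by (intro add_mono sum_bounded_above) (auto simp: G_def)
    also have "\<dots> \<le> real (card G) * real K + real (?n ^ r) * real T"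
      using card_mono[OF L(1), of "L - G"] L(2) by (intro add_left_mono mult_right_mono) auto
    also have "\<dots> \<le> real (card G) * real K + real (?n ^ r) * (\<epsilon> * real K / 4)"
      using K by (intro add_left_mono mult_left_mono) auto
    finally have "real K * (\<epsilon> / 4 * real ?n ^ r) \<le> real K * real (card G)"
      by (simp add: algebra_simps)
    then have cG: "\<epsilon> / 4 * real ?n ^ r \<le> real (card G)" using K(2) by (simp add: mult_le_cancel_left)
    have "\<exists>Q'\<in>Pow Q. \<epsilon>' * real ?n ^ r \<le> real (card {zs\<in>G. c zs = Q'})"
    proof (rule ccontr)
      assume neg: "\<not> ?thesis"
      have lt: "real (card {zs\<in>G. c zs = Q'}) < \<epsilon>' * real ?n ^ r" if "Q' \<in> Pow Q" for Q'
        using neg that not_le by blast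
      have "c zs \<in> Pow Q" for zs unfolding c_def by auto
      then have "G = (\<Union>Q'\<in>Pow Q. {zs\<in>G. c zs = Q'})" by blast
      then have "card G \<le> (\<Sum>Q'\<in>Pow Q. card {zs\<in>G. c zs = Q'})"
        using card_UN_le[of "Pow Q" "\<lambda>Q'. {zs\<in>G. c zs = Q'}"] Q(3) by (metis finite_Pow_iff)
      then have "real (card G) \<le> (\<Sum>Q'\<in>Pow Q. real (card {zs\<in>G. c zs = Q'}))"
        by (simp only: of_nat_sum[symmetric] of_nat_le_iff)
      also have "\<dots> < (\<Sum>Q'\<in>Pow Q. \<epsilon>' * real ?n ^ r)"
        using lt Q(3) by (intro sum_strict_mono) auto
      also have "\<dots> = \<epsilon> / 4 * real ?n ^ r" using Q by (simp add: card_Pow \<epsilon>'_def)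
      finally show False using cG by simp
    qed
    then obtain Q' where Q': "Q' \<subseteq> Q" "\<epsilon>' * real ?n ^ r \<le> real (card {zs\<in>G. c zs = Q'})" by auto
    define A2 where "A2 = {zs\<in>G. c zs = Q'}"
    have "A2 \<subseteq> {zs. set zs \<subseteq> V \<and> length zs = r}" unfolding A2_def G_def L_def by auto
    from n0[OF V nn(1) this] Q'(2) obtain Ss where Ss: "length Ss = r"
      "\<And>S. S \<in> set Ss \<Longrightarrow> S \<subseteq> V \<and> card S = T" "{xs. list_all2 (\<in>) xs Ss} \<subseteq> A2"
      unfolding A2_def by blast
    \<comment> \<open>A single tail in \<open>A2\<close> is needed to learn that its set
      \<open>Q'\<close> of first coordinates has at least T elements.\<close>
    have "real (card A2) > 0"
      using Q'(2) \<open>\<epsilon>' > 0\<close> nn(3) unfolding A2_def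
      by (smt (verit) mult_pos_pos of_nat_0_less_iff zero_less_power less_le_trans zero_less_one of_nat_le_iff of_nat_1)
    then have "A2 \<noteq> {}" by auto
    then have "T \<le> card Q'" unfolding A2_def G_def by auto
    then obtain S where S: "S \<subseteq> Q'" "card S = T" by (meson obtain_subset_with_card_n)
    show "\<exists>Ss. length Ss = Suc r \<and> (\<forall>S\<in>set Ss. S \<subseteq> V \<and> card S = T) \<and> {xs. list_all2 (\<in>) xs Ss} \<subseteq> A"
    proof (intro exI[of _ "S # Ss"] conjI)
      show "{xs. list_all2 (\<in>) xs (S # Ss)} \<subseteq> A"
      proof
        fix xs assume "xs \<in> {xs. list_all2 (\<in>) xs (S # Ss)}"
        then obtain u zs where x: "xs = u # zs" "u \<in> S" "list_all2 (\<in>) zs Ss"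
          by (auto simp: list_all2_Cons2)
        then have "zs \<in> A2" using Ss(3) by auto
        then show "xs \<in> A" using x S unfolding A2_def c_def by auto
      qed
    qed (use Ss S Q' Q Q0 in auto)
  qed
qed

section \<open>Copies through a given vertex\<close>

lemma card_supersets:
  assumes "finite V" "Y \<subseteq> V" "card Y \<le> r"
  shows "card {e. e \<subseteq> V \<and> card e = r \<and> Y \<subseteq> e} = (card V - card Y choose (r - card Y))"
proof -
  have fY: "finite Y" using assms finite_subset by blast
  have "bij_betw (\<lambda>e. e - Y) {e. e \<subseteq> V \<and> card e = r \<and> Y \<subseteq> e} {f. f \<subseteq> V - Y \<and> card f = r - card Y}"
  proof (rule bij_betwI[where g = "\<lambda>f. f \<union> Y"])
    show "(\<lambda>e. e - Y) \<in> {e. e \<subseteq> V \<and> card e = r \<and> Y \<subseteq> e} \<rightarrow> {f. f \<subseteq> V - Y \<and> card f = r - card Y}"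
      using fY by (auto simp: card_Diff_subset)
    show "(\<lambda>f. f \<union> Y) \<in> {f. f \<subseteq> V - Y \<and> card f = r - card Y} \<rightarrow> {e. e \<subseteq> V \<and> card e = r \<and> Y \<subseteq> e}"
    proof
      fix f assume f: "f \<in> {f. f \<subseteq> V - Y \<and> card f = r - card Y}"
      then have "finite f" using assms(1) finite_subset by blast
      then have "card (f \<union> Y) = card f + card Y" using f fY by (intro card_Un_disjoint) auto
      then show "f \<union> Y \<in> {e. e \<subseteq> V \<and> card e = r \<and> Y \<subseteq> e}" using f assms by auto
    qed
  qed auto
  then have "card {e. e \<subseteq> V \<and> card e = r \<and> Y \<subseteq> e} = card {f. f \<subseteq> V - Y \<and> card f = r - card Y}"
    by (rule bij_betw_same_card)
  also have "\<dots> = (card (V - Y) choose (r - card Y))" using assms(1) by (simp add: n_subsets)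
  finally show ?thesis using assms fY by (simp add: card_Diff_subset)
qed

lemma card_sets_through_vertex:
  assumes "finite V" "v \<in> V" "1 \<le> r"
  shows "card {e. e \<subseteq> V \<and> card e = r \<and> v \<in> e} = (card V - 1 choose (r - 1))"
  using card_supersets[of V "{v}" r] assms by simp

lemma card_sets_through_two_vertices:
  assumes "finite V" "v \<in> V" "w \<in> V" "v \<noteq> w" "2 \<le> r"
  shows "card {e. e \<subseteq> V \<and> card e = r \<and> v \<in> e \<and> w \<in> e} = (card V - 2 choose (r - 2))"
  using card_supersets[of V "{v, w}" r] assms by (simp add: numeral_2_eq_2)

text \<open>The quotient of the two binomials is (r-1)/(n-1), which is at most r/n for r \<le> n. So
  fixing a second vertex of an edge costs a factor r/n.\<close>

lemma choose_codegree_le: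
  assumes "2 \<le> r" "r \<le> n"
  shows "n * (n - 2 choose (r - 2)) \<le> r * (n - 1 choose (r - 1))"
proof -
  obtain r' where r: "r = Suc (Suc r')" using assms(1) by (metis Suc_le_D numeral_2_eq_2 Suc_le_mono)
  obtain n' where n: "n = Suc (Suc n')" using assms by (metis Suc_le_D numeral_2_eq_2 Suc_le_mono le_trans)
  have eq: "Suc r' * (Suc n' choose Suc r') = Suc n' * (n' choose r')"
    using Suc_times_binomial_eq[of n' r'] by (simp only: mult.commute)
  have "Suc (Suc n') * Suc r' \<le> Suc (Suc r') * Suc n'"
    using assms r n by simp
  then have "Suc (Suc n') * Suc r' * (n' choose r') \<le> Suc (Suc r') * (Suc n' * (n' choose r'))"
    by (metis mult.assoc mult_le_mono1)
  also have "\<dots> = Suc r' * (Suc (Suc r') * (Suc n' choose Suc r'))"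
    using eq by (metis mult.left_commute)
  finally have "Suc r' * (Suc (Suc n') * (n' choose r')) \<le> Suc r' * (Suc (Suc r') * (Suc n' choose Suc r'))"
    by (simp only: ac_simps)
  then show ?thesis unfolding r n by (simp del: mult_Suc mult_Suc_right)
qed

section \<open>Embedding an r-partite graph into a box\<close>

definition rpartition :: "nat \<Rightarrow> (nat \<Rightarrow> nat) \<Rightarrow> (nat \<Rightarrow> 'a set) \<Rightarrow> 'a set \<Rightarrow> 'a set set \<Rightarrow> bool" where
  "rpartition r sz W V E \<longleftrightarrow> rgraph r V E \<and> V = (\<Union>i<r. W i) \<and>
     (\<forall>i<r. \<forall>j<r. i \<noteq> j \<longrightarrow> W i \<inter> W j = {}) \<and>
     (\<forall>i<r. card (W i) = sz i) \<and>
     (\<forall>e\<in>E. \<forall>i<r. card (e \<inter> W i) = 1)"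

lemma rpartite_iff_rpartition: "rpartite r sz V E \<longleftrightarrow> (\<exists>W. rpartition r sz W V E)"
  unfolding rpartite_def rpartition_def by simp

lemma rpartitionD:
  assumes "rpartition r sz W VB EB"
  shows "VB = (\<Union>i<r. W i)" "\<lbrakk>i < r; j < r; i \<noteq> j\<rbrakk> \<Longrightarrow> W i \<inter> W j = {}"
    "i < r \<Longrightarrow> card (W i) = sz i" "i < r \<Longrightarrow> finite (W i)"
    "e \<in> EB \<Longrightarrow> i < r \<Longrightarrow> card (e \<inter> W i) = 1"
    "finite VB" "e \<in> EB \<Longrightarrow> e \<subseteq> VB \<and> card e = r"
proof -
  show VB: "VB = (\<Union>i<r. W i)" "finite VB" using assms unfolding rpartition_def rgraph_def by auto
  show "finite (W i)" if "i < r" using VB that by (intro finite_subset[of "W i" VB]) auto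
  show "e \<subseteq> VB \<and> card e = r" if "e \<in> EB" using assms that unfolding rpartition_def rgraph_def by blast
qed (use assms in \<open>simp_all add: rpartition_def\<close>)

lemma rpartite_card_vertices:
  assumes "rpartite r sz VB EB"
  shows "card VB = (\<Sum>i<r. sz i)"
proof -
  obtain W where "rpartition r sz W VB EB" using assms unfolding rpartite_iff_rpartition by blast
  note W = rpartitionD[OF this]
  have "card VB = (\<Sum>i<r. card (W i))" unfolding W(1) using W by (intro card_UN_disjoint) auto
  then show ?thesis using W(3) by simp
qed

text \<open>An edge is determined by the vertex it picks in each part, so the edges inject into the
  product of the parts. This is how the product of the part sizes enters the constants.\<close>

lemma rpartite_card_edges_le:
  assumes "rpartite r sz VB EB"
  shows "card EB \<le> (\<Prod>i<r. sz i)" "finite EB"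
proof -
  obtain W where "rpartition r sz W VB EB" using assms unfolding rpartite_iff_rpartition by blast
  note W = rpartitionD[OF this]
  have "EB \<subseteq> Pow VB" using W(7) by blast
  then show "finite EB" using W(6) by (meson finite_Pow_iff finite_subset)
  have sing: "\<exists>x. e \<inter> W i = {x}" if "e \<in> EB" "i < r" for e i
    using W(5)[OF that] by (simp add: card_1_singleton_iff)
  define p where "p e = (\<lambda>i\<in>{..<r}. THE x. e \<inter> W i = {x})" for e
  have pe: "e \<inter> W i = {p e i}" if "e \<in> EB" "i < r" for e i
    using sing[OF that] that unfolding p_def by (auto intro: theI2)
  have "inj_on p EB"
  proof (rule inj_onI)
    fix e e' assume h: "e \<in> EB" "e' \<in> EB" "p e = p e'"
    have "e = (\<Union>i<r. e \<inter> W i)" using W(7)[OF h(1)] W(1) by blast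
    also have "\<dots> = (\<Union>i<r. e' \<inter> W i)" using pe h by simp
    also have "\<dots> = e'" using W(7)[OF h(2)] W(1) by blast
    finally show "e = e'" .
  qed
  moreover have "p ` EB \<subseteq> (\<Pi>\<^sub>E i\<in>{..<r}. W i)"
  proof (rule image_subsetI)
    fix e assume "e \<in> EB"
    then have "p e i \<in> W i" if "i < r" for i using pe[of e i] that by blast
    then show "p e \<in> (\<Pi>\<^sub>E i\<in>{..<r}. W i)" unfolding PiE_def p_def by auto
  qed
  ultimately have "card EB \<le> card (\<Pi>\<^sub>E i\<in>{..<r}. W i)"
    using W(4) by (intro card_inj_on_le[of p]) (auto intro: finite_PiE)
  then show "card EB \<le> (\<Prod>i<r. sz i)" using W(3) by (simp add: card_PiE)
qed

text \<open>The last hypothesis lets \<open>v\<close> play the role of a vertex in the first part.\<close>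
lemma copy_on_in_box:
  assumes part: "rpartite r sz VB EB" and "1 \<le> r" "1 \<le> sz 0"
    and Ss: "length Ss = r" "\<And>S. S \<in> set Ss \<Longrightarrow> card S = T" "\<And>i. i < r \<Longrightarrow> sz i \<le> T" "1 \<le> T"
    and box: "\<And>xs. list_all2 (\<in>) xs Ss \<Longrightarrow> distinct xs \<and> v \<notin> set xs \<and> set xs \<subseteq> X
      \<and> set xs \<in> E \<and> insert v (set (tl xs)) \<in> E"
  shows "\<exists>S. copy_on (VB, EB) E S \<and> v \<in> S \<and> S \<subseteq> insert v X"
proof -
  obtain W where "rpartition r sz W VB EB" using part unfolding rpartite_iff_rpartition by blast
  note W = rpartitionD[OF this]
  have "card (W 0) \<noteq> 0" using W(3)[of 0] assms(2,3) by simp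
  then obtain x0 where x0: "x0 \<in> W 0" by (metis card.empty ex_in_conv)
  have cS: "card (Ss ! i) = T" if "i < r" for i using Ss(1,2) that by simp
  have "\<exists>h. inj_on h (W i) \<and> h ` W i \<subseteq> Ss ! i" if "i < r" for i
  proof -
    have "finite (Ss ! i)" using cS[OF that] Ss(4) by (metis card.infinite not_one_le_zero)
    moreover have "card (W i) \<le> card (Ss ! i)" using W(3)[OF that] Ss(3)[OF that] cS[OF that] by simp
    ultimately show ?thesis using W(4)[OF that] card_le_inj by metis
  qed
  then obtain h where h: "\<And>i. i < r \<Longrightarrow> inj_on (h i) (W i)" "\<And>i. i < r \<Longrightarrow> h i ` W i \<subseteq> Ss ! i"
    by metis
  have "\<exists>y. y \<in> Ss ! i" if "i < r" for i
    using cS[OF that] Ss(4) by (metis card.empty ex_in_conv not_one_le_zero)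
  then obtain y0 where y0: "\<And>i. i < r \<Longrightarrow> y0 i \<in> Ss ! i" by metis
  have boxc: "distinct (map c [0..<r]) \<and> v \<notin> c ` {..<r} \<and> c ` {..<r} \<subseteq> X \<and> c ` {..<r} \<in> E
      \<and> insert v (c ` {1..<r}) \<in> E" if "\<And>i. i < r \<Longrightarrow> c i \<in> Ss ! i" for c
  proof -
    have "list_all2 (\<in>) (map c [0..<r]) Ss" using that Ss(1) by (simp add: list_all2_conv_all_nth)
    moreover have "tl (map c [0..<r]) = map c [1..<r]" using assms(2) by (simp add: upt_conv_Cons)
    ultimately show ?thesis using box[of "map c [0..<r]"] by (simp add: atLeast0LessThan)
  qed
  \<comment> \<open>An element common to two sides could be chosen in both coordinates at once, but
    the tuples of the box are distinct.\<close>
  have disj: "y \<notin> Ss ! j" if "i < r" "j < r" "i \<noteq> j" "y \<in> Ss ! i" for i j y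
  proof
    assume "y \<in> Ss ! j"
    then have "distinct (map (y0(i := y, j := y)) [0..<r])" using that y0 boxc[of "y0(i := y, j := y)"] by simp
    then show False using that by (auto simp: distinct_map inj_on_def)
  qed
  have inX: "y \<in> X \<and> y \<noteq> v" if "i < r" "y \<in> Ss ! i" for i y
  proof -
    have "v \<notin> y0(i := y) ` {..<r} \<and> y0(i := y) ` {..<r} \<subseteq> X" using that y0 boxc[of "y0(i := y)"] by simp
    moreover have "y \<in> y0(i := y) ` {..<r}" using that by (auto simp: image_iff)
    ultimately show ?thesis by blast
  qed
  define idx where "idx x = (THE i. i < r \<and> x \<in> W i)" for x
  have idx: "idx x = i" if "i < r" "x \<in> W i" for x i
    unfolding idx_def using that W(2) by (intro the_equality) blast+
  \<comment> \<open>\<open>x0\<close> goes to v and every other vertex into the side of its part. An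
    edge through \<open>x0\<close> becomes v with a tail, any other edge a full tuple; the box
    supplies both kinds.\<close>
  define g where "g x = (if x = x0 then v else h (idx x) x)" for x
  have gW: "g x \<in> Ss ! i \<and> g x = h i x" if "i < r" "x \<in> W i" "x \<noteq> x0" for x i
    using that idx[of i x] h(2)[of i] unfolding g_def by auto
  have inj: "inj_on g VB"
  proof (rule inj_onI)
    fix x y assume xy: "x \<in> VB" "y \<in> VB" "g x = g y"
    obtain i j where ij: "i < r" "x \<in> W i" "j < r" "y \<in> W j" using xy W(1) by auto
    consider "x = x0" "y = x0" | "x = x0" "y \<noteq> x0" | "x \<noteq> x0" "y = x0" | "x \<noteq> x0" "y \<noteq> x0" by blast
    then show "x = y"
    proof cases
      case 1 then show ?thesis by simp
    next
      case 2
      moreover have "g x0 = v" unfolding g_def by simp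
      ultimately have "v \<in> Ss ! j" using gW[of j y] ij xy by metis
      then show ?thesis using inX ij by blast
    next
      case 3
      moreover have "g x0 = v" unfolding g_def by simp
      ultimately have "v \<in> Ss ! i" using gW[of i x] ij xy by metis
      then show ?thesis using inX ij by blast
    next
      case 4
      have gx: "g x \<in> Ss ! i" "g x = h i x" using gW[OF ij(1,2) 4(1)] by auto
      have gy: "g y \<in> Ss ! j" "g y = h j y" using gW[OF ij(3,4) 4(2)] by auto
      have "i = j" using disj[OF ij(1,3)] gx gy xy(3) by metis
      then show ?thesis using h(1)[OF ij(1)] ij gx gy xy(3) unfolding inj_on_def by metis
    qed
  qed
  have edge: "g ` e \<in> E" if e: "e \<in> EB" for e
  proof -
    have "\<exists>x. e \<inter> W i = {x}" if "i < r" for i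
      using W(5)[OF e that] by (simp add: card_1_singleton_iff)
    then obtain w where w: "\<And>i. i < r \<Longrightarrow> e \<inter> W i = {w i}" by metis
    have ew: "e = w ` {..<r}"
    proof -
      have "e = (\<Union>i<r. e \<inter> W i)" using W(7)[OF e] W(1) by blast
      also have "\<dots> = w ` {..<r}" using w by auto
      finally show ?thesis .
    qed
    have wW: "w i \<in> W i" if "i < r" for i using w[OF that] by blast
    define c where "c i = h i (w i)" for i
    have "c i \<in> Ss ! i" if "i < r" for i using h(2)[OF that] wW[OF that] unfolding c_def by blast
    note bc = boxc[of c, OF this]
    have gw: "g (w i) = c i" if "i < r" "w i \<noteq> x0" for i
      using gW[of i "w i"] wW that unfolding c_def by blast
    show ?thesis
    proof (cases "x0 \<in> e")
      case False
      then have "w i \<noteq> x0" if "i < r" for i using ew that by blast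
      then have "g ` e = c ` {..<r}" unfolding ew image_image using gw by (intro image_cong) auto
      then show ?thesis using bc by simp
    next
      case True
      then have w0: "w 0 = x0" using w[of 0] x0 assms(2) by (metis IntI One_nat_def Suc_le_lessD singletonD)
      have "w i \<noteq> x0" if "i \<in> {1..<r}" for i
        using wW[of i] W(2)[of 0 i] x0 that by auto
      then have "g ` w ` {1..<r} = c ` {1..<r}" unfolding image_image using gw by (intro image_cong) auto
      moreover have "{..<r} = insert 0 {1..<r}" using assms(2) by auto
      moreover have "g x0 = v" unfolding g_def by simp
      ultimately have "g ` e = insert v (c ` {1..<r})" unfolding ew using w0 by simp
      then show ?thesis using bc by simp
    qed
  qed
  have "copy_on (VB, EB) E (g ` VB)"
    unfolding copy_on_def using inj edge by (auto simp: bij_betw_def)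
  moreover have "v \<in> g ` VB"
  proof -
    have "x0 \<in> VB" using x0 W(1) assms(2) by auto
    moreover have "v = g x0" unfolding g_def by simp
    ultimately show ?thesis by blast
  qed
  moreover have "g ` VB \<subseteq> insert v X"
  proof (rule image_subsetI)
    fix x assume "x \<in> VB"
    then obtain i where "i < r" "x \<in> W i" using W(1) by auto
    then show "g x \<in> insert v X" using gW[of i x] inX[of i "g x"] by (cases "x = x0") (auto simp: g_def)
  qed
  ultimately show ?thesis by blast
qed

section \<open>Extensions of the link of a vertex\<close>

definition nonedges :: "nat \<Rightarrow> 'a set \<Rightarrow> 'a set set \<Rightarrow> 'a set set" where
  "nonedges r V E = {e. e \<subseteq> V \<and> card e = r \<and> e \<notin> E}"

text \<open>Let D = C(n-1, r-1). Each set z of the link of v that avoids Z has at least n/2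
  candidates u, and the failing candidates inject into pairs of a missing edge and one of its
  vertices, at most r m D in all. In \<open>deg\<close> the term with |Z| pays for edges through v
  that meet Z, 4 r m for failing candidates, and \<kappa> n is the gain, halved by the n/2.\<close>

lemma many_extensions_of_link:
  fixes E :: "'a set set" and V :: "'a set"
  assumes "2 \<le> r" "finite V" and E: "\<And>e. e \<in> E \<Longrightarrow> e \<subseteq> V \<and> card e = r"
    and v: "v \<in> V" "v \<notin> Z" and Z: "Z \<subseteq> V" "2 * (card Z + r) \<le> card V"
    and miss: "real (card (nonedges r V E)) \<le> real m * real (card V - 1 choose (r - 1))"
    and deg: "(real r * real (card Z) + 4 * real r * real m + \<kappa> * real (card V)) * real (card V - 1 choose (r - 1))
      \<le> real (card V) * real (card {e\<in>E. v \<in> e})"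
  shows "\<kappa> / 2 * real (card V) * real (card V - 1 choose (r - 1))
    \<le> real (card {(u, z). z \<subseteq> V - Z - {v} \<and> insert v z \<in> E \<and> u \<in> V - Z - {v} - z \<and> insert u z \<in> E})"
proof -
  let ?n = "card V"
  let ?D = "real (?n - 1 choose (r - 1))"
  define X where "X = V - Z - {v}"
  have finE: "finite E" using E assms(2) finite_subset[of E "Pow V"] by blast
  have finX: "finite X" "finite Z" using assms(2) Z finite_subset unfolding X_def by auto
  have cX: "card X = ?n - card Z - 1"
    unfolding X_def using assms(2) v Z finX by (simp add: card_Diff_subset)
  define L where "L = {z. z \<subseteq> X \<and> insert v z \<in> E}"
  have finL: "finite L" unfolding L_def using finX by simp
  have Lz: "finite z" "card z = r - 1" "z \<subseteq> X" if "z \<in> L" for z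
  proof -
    show z: "z \<subseteq> X" "finite z" using that finX finite_subset unfolding L_def by auto
    have "v \<notin> z" using z unfolding X_def by auto
    then have "card (insert v z) = Suc (card z)" using z by simp
    then show "card z = r - 1" using that E unfolding L_def by force
  qed
  have d: "real ?n * real (card {e\<in>E. v \<in> e}) \<le> real ?n * real (card L) + real r * real (card Z) * ?D"
  proof -
    have "{e\<in>E. v \<in> e} \<subseteq> insert v ` L \<union> {e\<in>{e\<in>E. v \<in> e}. e \<inter> Z \<noteq> {}}"
    proof
      fix e assume e: "e \<in> {e\<in>E. v \<in> e}"
      show "e \<in> insert v ` L \<union> {e\<in>{e\<in>E. v \<in> e}. e \<inter> Z \<noteq> {}}"
      proof (cases "e \<inter> Z = {}")
        case True
        then have "e - {v} \<in> L" using e E unfolding L_def X_def by (auto simp: insert_absorb)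
        moreover have "e = insert v (e - {v})" using e by auto
        ultimately show ?thesis by blast
      qed (use e in auto)
    qed
    then have "card {e\<in>E. v \<in> e} \<le> card (insert v ` L \<union> {e\<in>{e\<in>E. v \<in> e}. e \<inter> Z \<noteq> {}})"
      using finL finE by (intro card_mono) auto
    also have "\<dots> \<le> card (insert v ` L) + card {e\<in>{e\<in>E. v \<in> e}. e \<inter> Z \<noteq> {}}" by (rule card_Un_le)
    also have "\<dots> \<le> card L + (\<Sum>z\<in>Z. card {e\<in>{e\<in>E. v \<in> e}. z \<in> e})"
      using finE finX card_image_le[OF finL] by (intro add_mono card_meeting_le_sum_degrees) auto
    also have "\<dots> \<le> card L + card Z * (?n - 2 choose (r - 2))"
    proof (intro add_left_mono order_trans[OF sum_bounded_above])
      fix z assume "z \<in> Z"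
      then have "card {e. e \<subseteq> V \<and> card e = r \<and> v \<in> e \<and> z \<in> e} = (?n - 2 choose (r - 2))"
        using assms(1,2) v Z by (intro card_sets_through_two_vertices) auto
      moreover have "card {e\<in>{e\<in>E. v \<in> e}. z \<in> e} \<le> card {e. e \<subseteq> V \<and> card e = r \<and> v \<in> e \<and> z \<in> e}"
        using E assms(2) by (intro card_mono) auto
      ultimately show "card {e\<in>{e\<in>E. v \<in> e}. z \<in> e} \<le> (?n - 2 choose (r - 2))" by simp
    qed simp
    finally have "card {e\<in>E. v \<in> e} \<le> card L + card Z * (?n - 2 choose (r - 2))" .
    then have "?n * card {e\<in>E. v \<in> e} \<le> ?n * (card L + card Z * (?n - 2 choose (r - 2)))"
      by (rule mult_le_mono2)
    also have "\<dots> = ?n * card L + card Z * (?n * (?n - 2 choose (r - 2)))"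
      by (simp add: algebra_simps)
    also have "\<dots> \<le> ?n * card L + card Z * (r * (?n - 1 choose (r - 1)))"
      using choose_codegree_le[of r ?n] assms(1) Z by (intro add_left_mono mult_le_mono2) auto
    finally have "real (?n * card {e\<in>E. v \<in> e}) \<le> real (?n * card L + card Z * (r * (?n - 1 choose (r - 1))))"
      by (simp only: of_nat_le_iff)
    then show ?thesis by (simp add: algebra_simps)
  qed
  define P where "P = Sigma L (\<lambda>z. X - z)"
  have finP: "finite P" unfolding P_def using finL finX by auto
  have cP: "card P = card L * (?n - card Z - r)"
  proof -
    have "card P = (\<Sum>z\<in>L. card (X - z))" unfolding P_def using finL finX by (intro card_SigmaI) auto
    also have "\<dots> = (\<Sum>z\<in>L. ?n - card Z - r)"
      using Lz cX assms(1) by (intro sum.cong) (auto simp: card_Diff_subset)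
    finally show ?thesis by simp
  qed
  define Pb where "Pb = {(z, u)\<in>P. insert u z \<notin> E}"
  define Pg where "Pg = {(z, u)\<in>P. insert u z \<in> E}"
  let ?M = "nonedges r V E"
  have finM: "finite ?M" unfolding nonedges_def using assms(2) by simp
  have "card Pb \<le> card (Sigma ?M (\<lambda>f. f))"
  proof (rule card_inj_on_le[of "\<lambda>(z, u). (insert u z, u)"])
    show "inj_on (\<lambda>(z, u). (insert u z, u)) Pb"
      unfolding inj_on_def Pb_def P_def by (auto simp: insert_ident)
    show "(\<lambda>(z, u). (insert u z, u)) ` Pb \<subseteq> Sigma ?M (\<lambda>f. f)"
    proof (rule image_subsetI)
      fix p assume "p \<in> Pb"
      then obtain z u where p: "p = (z, u)" "z \<in> L" "u \<in> X - z" "insert u z \<notin> E"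
        unfolding Pb_def P_def by auto
      then have "card (insert u z) = r" using Lz[OF p(2)] assms(1) by simp
      moreover have "insert u z \<subseteq> V" using p Lz[OF p(2)] unfolding X_def by auto
      ultimately show "(\<lambda>(z, u). (insert u z, u)) p \<in> Sigma ?M (\<lambda>f. f)"
        using p unfolding nonedges_def by simp
    qed
    show "finite (Sigma ?M (\<lambda>f. f))"
      using finM assms(2) finite_subset by (intro finite_SigmaI) (auto simp: nonedges_def)
  qed
  also have "\<dots> = (\<Sum>f\<in>?M. card f)"
    using finM assms(2) finite_subset by (intro card_SigmaI) (auto simp: nonedges_def)
  also have "\<dots> = r * card ?M" by (simp add: nonedges_def)
  finally have cPb: "real (card Pb) \<le> real r * real (card ?M)" by (metis of_nat_le_iff of_nat_mult)
  have "P = Pb \<union> Pg" unfolding Pb_def Pg_def by auto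
  then have "card P \<le> card Pb + card Pg" by (metis card_Un_le)
  then have cPg: "real (card P) \<le> real (card Pb) + real (card Pg)" by linarith
  have "card Pg \<le> card {(u, z). z \<subseteq> V - Z - {v} \<and> insert v z \<in> E \<and> u \<in> V - Z - {v} - z \<and> insert u z \<in> E}"
  proof (rule card_inj_on_le[of prod.swap])
    show "prod.swap ` Pg \<subseteq> {(u, z). z \<subseteq> V - Z - {v} \<and> insert v z \<in> E \<and> u \<in> V - Z - {v} - z \<and> insert u z \<in> E}"
      unfolding Pg_def P_def L_def X_def by auto
    show "finite {(u, z). z \<subseteq> V - Z - {v} \<and> insert v z \<in> E \<and> u \<in> V - Z - {v} - z \<and> insert u z \<in> E}"
      using assms(2) by (intro finite_subset[OF _ finite_SigmaI[of V "\<lambda>_. Pow V"]]) auto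
  qed simp
  moreover have "\<kappa> / 2 * real ?n * ?D \<le> real (card Pg)"
  proof -
    have nL: "(4 * real r * real m + \<kappa> * real ?n) * ?D \<le> real ?n * real (card L)"
      using d deg by (simp add: algebra_simps)
    have "?n \<le> 2 * (?n - card Z - r)" using Z(2) by arith
    then have "real ?n / 2 \<le> real (?n - card Z - r)" by linarith
    then have "real (card L) * (real ?n / 2) \<le> real (card P)"
      unfolding cP of_nat_mult by (intro mult_left_mono) auto
    moreover have "real r * real (card ?M) \<le> real r * (real m * ?D)" using miss by (intro mult_left_mono) auto
    moreover have "0 \<le> real r * real m * ?D" by simp
    ultimately show ?thesis using nL cPb cPg by (simp add: algebra_simps)
  qed
  ultimately show ?thesis by linarith
qed

text \<open>The pairs (u, z) of the previous count, read as tuples, are dense and contain a box, in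
  which v is a twin of the first coordinates. \<open>n0\<close> is fixed before \<open>E\<close>,
  \<open>Z\<close>, \<open>v\<close> and \<open>m\<close>, so one value serves all t.\<close>

lemma exists_copy_through_vertex:
  assumes "2 \<le> r" and part: "rpartite r sz VB EB" and "1 \<le> sz 0" and "\<kappa> > 0"
  shows "\<exists>n0. \<forall>n\<ge>n0. \<forall>E Z v m. rgraph r {..<n} E \<longrightarrow> v < n \<longrightarrow> v \<notin> Z \<longrightarrow> Z \<subseteq> {..<n}
    \<longrightarrow> 2 * (card Z + r) \<le> n
    \<longrightarrow> real (card (nonedges r {..<n} E)) \<le> real m * real (n - 1 choose (r - 1))
    \<longrightarrow> (real r * real (card Z) + 4 * real r * real m + \<kappa> * real n) * real (n - 1 choose (r - 1))
      \<le> real n * real (card {e\<in>E. v \<in> e})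
    \<longrightarrow> (\<exists>S. copy_on (VB, EB) E S \<and> v \<in> S \<and> S \<inter> Z = {} \<and> S \<subseteq> {..<n})"
proof -
  \<comment> \<open>There are at least \<kappa>/2 * n * D tuples, with D = C(n-1, r-1) \<ge>
    (n/r)^(r-1).\<close>
  define \<epsilon> where "\<epsilon> = \<kappa> / 2 / real r ^ (r - 1)"
  define T where "T = (\<Sum>i<r. sz i)"
  have szT: "sz i \<le> T" if "i < r" for i
    unfolding T_def using that by (intro member_le_sum) auto
  then have T1: "1 \<le> T" using assms(1,3) by (metis le_trans less_le_trans zero_less_numeral)
  have "\<epsilon> > 0" unfolding \<epsilon>_def using assms by simp
  from dense_set_of_lists_contains_box[OF this, of r T]
  obtain n0 where n0: "\<And>(V :: nat set) A. finite V \<Longrightarrow> n0 \<le> card V \<Longrightarrow> A \<subseteq> {xs. set xs \<subseteq> V \<and> length xs = r}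
    \<Longrightarrow> \<epsilon> * real (card V) ^ r \<le> real (card A)
    \<Longrightarrow> \<exists>Ss. length Ss = r \<and> (\<forall>S\<in>set Ss. S \<subseteq> V \<and> card S = T) \<and> {xs. list_all2 (\<in>) xs Ss} \<subseteq> A"
    by blast
  show ?thesis
  proof (rule exI[of _ n0], intro allI impI)
    fix n and E :: "nat set set" and Z v m
    assume n: "n0 \<le> n" and gr: "rgraph r {..<n} E" and v: "v < n" "v \<notin> Z" and Z: "Z \<subseteq> {..<n}" "2 * (card Z + r) \<le> n"
      and miss: "real (card (nonedges r {..<n} E)) \<le> real m * real (n - 1 choose (r - 1))"
      and deg: "(real r * real (card Z) + 4 * real r * real m + \<kappa> * real n) * real (n - 1 choose (r - 1))
      \<le> real n * real (card {e\<in>E. v \<in> e})"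
    let ?D = "real (n - 1 choose (r - 1))"
    define X where "X = {..<n} - Z - {v}"
    define P where "P = {(u, z). z \<subseteq> X \<and> insert v z \<in> E \<and> u \<in> X - z \<and> insert u z \<in> E}"
    have E: "e \<subseteq> {..<n} \<and> card e = r" if "e \<in> E" for e using gr that unfolding rgraph_def by auto
    have P: "\<kappa> / 2 * real n * ?D \<le> real (card P)"
      using many_extensions_of_link[of r "{..<n}" E v Z m \<kappa>] assms(1) E v Z miss deg
      unfolding P_def X_def by simp
    have finX: "finite z" if "z \<subseteq> X" for z using that finite_subset unfolding X_def by blast
    \<comment> \<open>One ordering of z is enough: \<open>copy_on_in_box\<close> gives a special
      role only to the first coordinate and reads the tail as a set.\<close>
    define A where "A = (\<lambda>(u, z). u # sorted_list_of_set z) ` P"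
    have "inj_on (\<lambda>(u, z). u # sorted_list_of_set z) P"
    proof (rule inj_onI)
      fix p q assume pq: "p \<in> P" "q \<in> P"
        "(\<lambda>(u, z). u # sorted_list_of_set z) p = (\<lambda>(u, z). u # sorted_list_of_set z) q"
      then have "fst p = fst q" "sorted_list_of_set (snd p) = sorted_list_of_set (snd q)"
        by (auto simp: case_prod_beta)
      moreover have "finite (snd p)" "finite (snd q)" using pq finX unfolding P_def by auto
      ultimately show "p = q" by (metis prod.expand sorted_list_of_set.set_sorted_key_list_of_set)
    qed
    then have cA: "card A = card P" unfolding A_def by (rule card_image)
    have A: "distinct xs \<and> v \<notin> set xs \<and> set xs \<subseteq> X \<and> set xs \<in> E \<and> insert v (set (tl xs)) \<in> E \<and> length xs = r"
      if "xs \<in> A" for xs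
    proof -
      obtain u z where uz: "xs = u # sorted_list_of_set z" "z \<subseteq> X" "insert v z \<in> E" "u \<in> X - z" "insert u z \<in> E"
        using \<open>xs \<in> A\<close> unfolding A_def P_def by auto
      note fz = finX[OF uz(2)]
      have d: "distinct xs" and st: "set xs = insert u z" "set (tl xs) = z" using uz fz by auto
      have "length xs = r" using distinct_card[OF d] st(1) E[OF uz(5)] by simp
      moreover have "v \<notin> X" unfolding X_def by simp
      ultimately show ?thesis using d st uz by auto
    qed
    have "\<epsilon> * real n ^ r \<le> real (card A)"
    proof -
      have rn: "r \<le> n" "1 \<le> r" using Z(2) assms(1) by auto
      have "real n / real r \<le> real (n - 1) / real (r - 1)"
        using rn assms(1) by (simp add: divide_simps of_nat_diff algebra_simps)
      then have "(real n / real r) ^ (r - 1) \<le> (real (n - 1) / real (r - 1)) ^ (r - 1)"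
        by (intro power_mono) auto
      also have "\<dots> \<le> ?D" using rn by (intro binomial_ge_n_over_k_pow_k) auto
      finally have "\<kappa> / 2 * real n * (real n / real r) ^ (r - 1) \<le> \<kappa> / 2 * real n * ?D"
        using assms(4) by (intro mult_left_mono) auto
      moreover have "\<epsilon> * real n ^ r = \<kappa> / 2 * real n * (real n / real r) ^ (r - 1)"
        unfolding \<epsilon>_def using rn(2) by (cases r) (auto simp: power_divide)
      ultimately show ?thesis using P cA by simp
    qed
    moreover have "A \<subseteq> {xs. set xs \<subseteq> {..<n} \<and> length xs = r}" using A unfolding X_def by blast
    ultimately obtain Ss where Ss: "length Ss = r" "\<forall>S\<in>set Ss. S \<subseteq> {..<n} \<and> card S = T"
      "{xs. list_all2 (\<in>) xs Ss} \<subseteq> A"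
      using n0[of "{..<n}" A] n by auto
    have "\<exists>S. copy_on (VB, EB) E S \<and> v \<in> S \<and> S \<subseteq> insert v X"
    proof (rule copy_on_in_box[OF part])
      show "distinct xs \<and> v \<notin> set xs \<and> set xs \<subseteq> X \<and> set xs \<in> E \<and> insert v (set (tl xs)) \<in> E"
        if "list_all2 (\<in>) xs Ss" for xs using A Ss(3) that by blast
    qed (use Ss szT T1 assms in auto)
    then show "\<exists>S. copy_on (VB, EB) E S \<and> v \<in> S \<and> S \<inter> Z = {} \<and> S \<subseteq> {..<n}"
      using v unfolding X_def by blast
  qed
qed

section \<open>Completing partial packings\<close>

lemma exists_subset_of_smallest_values:
  fixes f :: "'a \<Rightarrow> nat"
  assumes "finite V" "m \<le> card V"
  shows "\<exists>V1\<subseteq>V. card V1 = m \<and> (\<forall>x\<in>V1. \<forall>y\<in>V - V1. f x \<le> f y)"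
  using assms(2)
proof (induction m)
  case 0
  then show ?case by (intro exI[of _ "{}"]) auto
next
  case (Suc m)
  then obtain V1 where V1: "V1 \<subseteq> V" "card V1 = m" "\<forall>x\<in>V1. \<forall>y\<in>V - V1. f x \<le> f y" by auto
  have "finite V1" using V1 assms(1) finite_subset by blast
  have "V - V1 \<noteq> {}" using V1 Suc.prems by auto
  then obtain a where a: "a \<in> V - V1" "\<forall>y\<in>V - V1. f a \<le> f y"
    using assms(1) arg_min_if_finite[of "V - V1" f] by (metis arg_min_least finite_Diff)
  show ?case
    using V1 a \<open>finite V1\<close> by (intro exI[of _ "insert a V1"]) auto
qed

text \<open>Greedy covering: a vertex of \<open>C\<close> that is still uncovered receives a copy
  avoiding all copies so far. One copy may cover several vertices of \<open>C\<close>, so the number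
  of copies is only bounded above; this bound keeps the used set within the size that
  \<open>step\<close> allows.\<close>

lemma packing_extend_covering:
  assumes "packing B E \<S>0" "\<Union>\<S>0 \<subseteq> V" "finite C" "finite (fst B)" "fst B \<noteq> {}"
    and step: "\<And>Z v. \<lbrakk>Z \<subseteq> V; card Z \<le> card (fst B) * (card \<S>0 + card C); v \<in> C; v \<notin> Z\<rbrakk>
      \<Longrightarrow> \<exists>S. copy_on B E S \<and> v \<in> S \<and> S \<inter> Z = {} \<and> S \<subseteq> V"
  shows "\<exists>\<S>. \<S>0 \<subseteq> \<S> \<and> packing B E \<S> \<and> card \<S> \<le> card \<S>0 + card C \<and> C \<subseteq> \<Union>\<S> \<and> \<Union>\<S> \<subseteq> V"
proof -
  have "\<exists>\<S>. \<S>0 \<subseteq> \<S> \<and> packing B E \<S> \<and> card \<S> \<le> card \<S>0 + card C' \<and> C' \<subseteq> \<Union>\<S> \<and> \<Union>\<S> \<subseteq> V" if "C' \<subseteq> C" for C'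
    using finite_subset[OF that assms(3)] that
  proof (induction C' rule: finite_induct)
    case empty
    then show ?case using assms by (intro exI[of _ \<S>0]) auto
  next
    case (insert v C')
    then obtain \<S> where \<S>: "\<S>0 \<subseteq> \<S>" "packing B E \<S>" "card \<S> \<le> card \<S>0 + card C'" "C' \<subseteq> \<Union>\<S>" "\<Union>\<S> \<subseteq> V"
      by auto
    show ?case
    proof (cases "v \<in> \<Union>\<S>")
      case True
      then show ?thesis using \<S> insert.hyps by (intro exI[of _ \<S>]) auto
    next
      case False
      have "card C' \<le> card C" using insert.prems assms(3) by (intro card_mono) auto
      then have "card (\<Union>\<S>) \<le> card (fst B) * (card \<S>0 + card C)"
        unfolding card_Union_packing(1)[OF \<S>(2) assms(4)] using \<S>(3) by (intro mult_le_mono2) linarith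
      then obtain S where S: "copy_on B E S" "v \<in> S" "S \<inter> \<Union>\<S> = {}" "S \<subseteq> V"
        using step[of "\<Union>\<S>" v] \<S>(5) False insert.prems by blast
      have pS: "packing B E {S}" unfolding packing_def disjoint_def using S(1) by simp
      have d: "\<Union>\<S> \<inter> \<Union>{S} = {}" using S(3) by auto
      have "card (\<S> \<union> {S}) = card \<S> + 1"
        using card_packing_Un[OF \<S>(2) pS d assms(5)] by simp
      then show ?thesis
        using packing_Un[OF \<S>(2) pS d] \<S> S insert.hyps by (intro exI[of _ "\<S> \<union> {S}"]) auto
    qed
  qed
  then show ?thesis by blast
qed

text \<open>Isolated vertices of \<open>F\<close> may have been embedded into \<open>Z\<close>; they are moved elsewhere.\<close>
lemma contains_avoiding:
  assumes "contains (V, E) F" "finite V" "finite (fst F)" "\<And>e. e \<in> snd F \<Longrightarrow> e \<subseteq> fst F"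
    and avoid: "\<And>e. e \<in> E \<Longrightarrow> e \<inter> Z = {}" and room: "card Z + card (fst F) \<le> card V" and "finite Z"
  shows "contains (V - Z, E) F"
proof -
  obtain f where f: "inj_on f (fst F)" "f ` fst F \<subseteq> V" "\<And>e. e \<in> snd F \<Longrightarrow> f ` e \<in> E"
    using assms(1) unfolding contains_def by auto
  define K where "K = \<Union>(snd F)"
  have K: "K \<subseteq> fst F" unfolding K_def using assms(4) by blast
  have fK: "f ` K \<inter> Z = {}"
  proof (rule equals0I)
    fix y assume "y \<in> f ` K \<inter> Z"
    then obtain e where "e \<in> snd F" "y \<in> f ` e" "y \<in> Z" unfolding K_def by auto
    then show False using avoid[OF f(3)] by auto
  qed
  have finK: "finite K" using K assms(3) finite_subset by blast
  have "card (fst F - K) \<le> card (V - Z - f ` K)"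
  proof -
    have "card (f ` K) = card K" using f(1) K by (meson card_image inj_on_subset)
    moreover have "card (V - Z) \<ge> card V - card Z" using assms(7) by (rule diff_card_le_card_Diff)
    moreover have "card (V - Z - f ` K) \<ge> card (V - Z) - card (f ` K)"
      using finK by (intro diff_card_le_card_Diff) auto
    moreover have "card (fst F - K) = card (fst F) - card K" using K finK by (simp add: card_Diff_subset)
    ultimately show ?thesis using room by linarith
  qed
  then obtain h where h: "inj_on h (fst F - K)" "h ` (fst F - K) \<subseteq> V - Z - f ` K"
    using assms(2,3) card_le_inj by (metis finite_Diff)
  define f' where "f' x = (if x \<in> K then f x else h x)" for x
  have f'K: "f' ` e = f ` e" if "e \<subseteq> K" for e
    using that unfolding f'_def by (intro image_cong) auto
  have f'h: "f' ` (fst F - K) = h ` (fst F - K)"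
    unfolding f'_def by (intro image_cong) auto
  have un: "fst F = K \<union> (fst F - K)" using K by blast
  have "inj_on f' K" using f(1) K unfolding f'_def inj_on_def by auto
  moreover have "inj_on f' (fst F - K)" using h(1) unfolding f'_def inj_on_def by auto
  moreover have "f' ` K \<inter> f' ` (fst F - K) = {}" using h(2) f'K[of K] f'h by auto
  ultimately have "inj_on f' (K \<union> (fst F - K))"
    by (subst inj_on_Un) blast
  then have "inj_on f' (fst F)" using un by simp
  moreover have "f' ` fst F \<subseteq> V - Z"
  proof -
    have "f' ` fst F = f' ` K \<union> f' ` (fst F - K)" using un by (metis image_Un)
    moreover have "f ` K \<subseteq> V" using f(2) K by blast
    ultimately show ?thesis using f'K[of K] f'h h(2) fK by auto
  qed
  moreover have "f' ` e \<in> E" if "e \<in> snd F" for e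
    using f'K[of e] f(3)[OF that] Union_upper[OF that] unfolding K_def by simp
  ultimately show ?thesis unfolding contains_def by auto
qed

text \<open>Add the k vertices one at a time: each creates at most C(a+k-1, j) new sets of size j +
  1.\<close>

lemma choose_add_le:
  "(a + k choose Suc j) \<le> (a choose Suc j) + k * (a + k - 1 choose j)"
proof (induction k)
  case (Suc k)
  have "k * (a + k - 1 choose j) \<le> k * (a + k choose j)"
    by (intro mult_le_mono2 binomial_right_mono) auto
  then have "(a + k choose Suc j) \<le> (a choose Suc j) + k * (a + k choose j)" using Suc by linarith
  then show ?case by simp
qed simp

text \<open>Origin of the 16. Since V - R has at most n/(2 r) vertices, C(n-1, r-1) is at most twice
  C(N-1, r-1), so the tolerance 1/(16 r P) in V becomes 1/(8 r P) in R. Then N C(N-1, r-1) = r C(N,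
  r) yields the inequality with 8 that the random placement requires.\<close>

lemma packing_of_high_degree_vertices:
  assumes "finite V" "R \<subseteq> V" "2 \<le> r" "r \<le> card V" "1 \<le> P"
    and "finite (fst B)" "fst B \<noteq> {}" "finite (snd B)" "card (snd B) \<le> P"
    and B: "\<And>e. e \<in> snd B \<Longrightarrow> e \<subseteq> fst B \<and> card e = r"
    and miss: "\<And>v. v \<in> R \<Longrightarrow> 16 * r * P * card {f\<in>nonedges r V E. v \<in> f} \<le> (card V - 1 choose (r - 1))"
    and big: "2 * r * (card V - card R) \<le> card V"
    and k: "card (fst B) * k \<le> card R"
  obtains \<S> where "packing B E \<S>" "card \<S> = k" "\<Union>\<S> \<subseteq> R"
proof -
  let ?n = "card V" let ?N = "card R"
  define D where "D = (?n - 1 choose (r - 1))"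
  define d where "d = D div (16 * r * P)"
  have finR: "finite R" using assms finite_subset by blast
  have Nn: "?N \<le> ?n" using assms(1,2) by (rule card_mono)
  have "2 * (?n - ?N) \<le> 2 * r * (?n - ?N)" using assms(3) by simp
  then have N1: "1 \<le> ?N" using big assms(3,4) Nn by linarith
  have dmiss: "card {f. f \<subseteq> R \<and> card f = r \<and> f \<notin> E \<and> v \<in> f} \<le> d" if "v \<in> R" for v
  proof -
    have "card {f. f \<subseteq> R \<and> card f = r \<and> f \<notin> E \<and> v \<in> f} \<le> card {f\<in>nonedges r V E. v \<in> f}"
      unfolding nonedges_def using assms(1,2) by (intro card_mono) auto
    also have "\<dots> \<le> d"
      unfolding d_def D_def using miss[OF that] assms(3,5)
      by (subst less_eq_div_iff_mult_less_eq) (auto simp: mult.commute)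
    finally show ?thesis .
  qed
  have D2: "D \<le> 2 * (?N - 1 choose (r - 1))"
  proof -
    obtain j where j: "r = Suc (Suc j)" using assms(3) by (metis Suc_le_D numeral_2_eq_2 Suc_le_mono)
    have "(?N - 1) + (?n - ?N) = ?n - 1" using N1 Nn by simp
    then have le: "D \<le> (?N - 1 choose (r - 1)) + (?n - ?N) * (?n - 2 choose (r - 2))"
      using choose_add_le[of "?N - 1" "?n - ?N" j] unfolding D_def j by (simp add: numeral_2_eq_2)
    have "r * (2 * ((?n - ?N) * (?n - 2 choose (r - 2)))) = (2 * r * (?n - ?N)) * (?n - 2 choose (r - 2))"
      by simp
    also have "\<dots> \<le> ?n * (?n - 2 choose (r - 2))" using big by (rule mult_le_mono1)
    also have "\<dots> \<le> r * D" unfolding D_def using choose_codegree_le assms(3,4) by simp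
    finally have "2 * ((?n - ?N) * (?n - 2 choose (r - 2))) \<le> D" using assms(3) by simp
    then show ?thesis using le by linarith
  qed
  have bound: "8 * ?N * card (snd B) * d \<le> (?N choose r)"
  proof -
    have absorb: "r * (?N choose r) = ?N * (?N - 1 choose (r - 1))"
      using assms(3) N1 times_binomial_minus1_eq[of r ?N] by simp
    have "16 * r * P * d \<le> D" unfolding d_def by (rule times_div_less_eq_dividend)
    then have "8 * r * P * d \<le> (?N - 1 choose (r - 1))" using D2 by linarith
    then have "?N * (8 * r * P * d) \<le> r * (?N choose r)" unfolding absorb by (rule mult_le_mono2)
    then have "r * (8 * ?N * P * d) \<le> r * (?N choose r)" by (simp add: algebra_simps)
    then have "8 * ?N * P * d \<le> (?N choose r)" using assms(3) by simp
    moreover have "8 * ?N * card (snd B) * d \<le> 8 * ?N * P * d"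
      using assms(9) by (intro mult_le_mono1 mult_le_mono2)
    ultimately show ?thesis by linarith
  qed
  have "1 \<le> r" using assms(3) by simp
  from packing_in_almost_complete[OF finR this assms(6,7,8) B dmiss bound k]
  show ?thesis using that by blast
qed

section \<open>Closing the loop between degree threshold and bad vertices\<close>

text \<open>Here D and D2 are the full degree and codegree, b counts the bad vertices, b' is |Q|, M
  counts the edges missing inside U and \<zeta> is the degree threshold. \<open>h1\<close> gives b
  \<le> 32 r^2 P m \<zeta>. Substituted into the equation for \<zeta>, which contains b, this bounds
  r s \<zeta> by 1/10. Then \<open>h2\<close> would make b' D/2 smaller than b' D/10.\<close>

lemma stability_constants_contradiction:
  fixes r s P m n b b' \<zeta> D D2 M :: real
  assumes "2 \<le> r" "2 \<le> s" "1 \<le> P" "0 \<le> m" "0 < n" "0 \<le> b" "1 \<le> b'" "0 < D" "0 \<le> D2"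
    and n1: "100 * r ^ 4 * s * P * m \<le> n" and n2: "100 * r ^ 2 * s ^ 3 \<le> n"
    and \<zeta>: "\<zeta> * n = r * (s * (b + s)) + 4 * r * m + n / (16 * r * s)"
    and D2: "n * D2 \<le> r * D"
    and h1: "b * (D / (16 * r * P) - m * D2) \<le> r * M" "M \<le> m * (\<zeta> * D)"
    and h2: "b' * (D - \<zeta> * D - m * D2) \<le> r * M" "M < s * b' * (\<zeta> * D)"
  shows False
proof -
  define x where "x = m / n"
  have x0: "0 \<le> x" and m: "m = x * n" using assms x_def by auto
  have pos: "0 < r" "0 < s" "0 < P" "0 < r * s" using assms by auto
  have x1: "100 * r ^ 4 * s * P * x \<le> 1"
  proof -
    have "n * (100 * r ^ 4 * s * P * x) \<le> n * 1" using n1 m by (simp add: algebra_simps)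
    then show ?thesis using assms(5) by (rule mult_left_le_imp_le)
  qed
  have mD2: "m * D2 \<le> r * x * D"
  proof -
    have "m * D2 = x * (n * D2)" using m by simp
    also have "\<dots> \<le> x * (r * D)" using D2 x0 by (rule mult_left_mono)
    finally show ?thesis by (simp add: algebra_simps)
  qed
  have "2 ^ 3 * 2 * 1 \<le> r ^ 3 * s * P" using assms(1-3) by (intro mult_mono power_mono) auto
  then have q0: "16 \<le> r ^ 3 * s * P" by simp
  have rx: "r * x \<le> 1 / 100"
  proof -
    have "16 * (r * x) \<le> (r ^ 3 * s * P) * (r * x)" using q0 x0 pos by (intro mult_right_mono) auto
    also have "\<dots> \<le> 1 / 100" using x1 by (simp add: power_def numeral_eq_Suc algebra_simps)
    finally show ?thesis using x0 pos by (smt (verit) mult_nonneg_nonneg)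
  qed
  have rx2: "r * x \<le> 1 / (32 * r * P)"
  proof -
    have "2 ^ 2 * 2 \<le> r ^ 2 * s" using assms(1,2) by (intro mult_mono power_mono) auto
    then have "8 * (r ^ 2 * P * x) \<le> (r ^ 2 * s) * (r ^ 2 * P * x)" using x0 pos by (intro mult_right_mono) auto
    also have "\<dots> \<le> 1 / 100" using x1 by (simp add: power_def numeral_eq_Suc algebra_simps)
    finally have "32 * (r ^ 2 * P * x) \<le> 1" by simp
    then show ?thesis using pos by (simp add: field_simps power2_eq_square)
  qed
  have b1: "b \<le> 32 * r ^ 2 * P * m * \<zeta>"
  proof -
    have "r * x * D \<le> 1 / (32 * r * P) * D" using rx2 assms(8) by (intro mult_right_mono) auto
    then have "D / (32 * r * P) \<le> D / (16 * r * P) - m * D2"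
      using mD2 by (simp add: field_simps)
    then have "b * (D / (32 * r * P)) \<le> b * (D / (16 * r * P) - m * D2)"
      using assms(6) by (rule mult_left_mono)
    also have "\<dots> \<le> r * (m * (\<zeta> * D))" using h1 pos by (meson le_less_trans mult_left_mono order_less_imp_le order_trans)
    finally have "D * b \<le> D * (32 * r ^ 2 * P * m * \<zeta>)"
      using pos by (simp add: field_simps power2_eq_square)
    then show ?thesis using assms(8) by (rule mult_left_le_imp_le)
  qed
  have \<zeta>0: "0 \<le> \<zeta>"
  proof -
    have "0 \<le> \<zeta> * n" unfolding \<zeta> using assms pos by simp
    then show ?thesis using assms(5) by (simp add: zero_le_mult_iff)
  qed
  have b2: "r * s * b \<le> 4 / 25 * n * \<zeta>"
  proof -
    have "r * s * b \<le> r * s * (32 * r ^ 2 * P * m * \<zeta>)" using b1 pos by (intro mult_left_mono) auto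
    also have "\<dots> = 16 * 2 * (r ^ 3 * s * P * m * \<zeta>)" by (simp add: power_def numeral_eq_Suc algebra_simps)
    also have "\<dots> \<le> 16 * r * (r ^ 3 * s * P * m * \<zeta>)" using assms pos \<zeta>0 by (intro mult_right_mono) auto
    also have "\<dots> = 4 / 25 * (100 * r ^ 4 * s * P * m) * \<zeta>" by (simp add: power_def numeral_eq_Suc algebra_simps)
    also have "\<dots> \<le> 4 / 25 * n * \<zeta>" using n1 \<zeta>0 by (intro mult_right_mono mult_left_mono) simp_all
    finally show ?thesis .
  qed
  have t1: "r * s * (r * s ^ 2) \<le> n / 100" using n2 by (simp add: power_def numeral_eq_Suc algebra_simps)
  have t2: "r * s * (4 * r * m) \<le> n / 100"
  proof -
    have "2 ^ 2 * 1 \<le> r ^ 2 * P" using assms(1,3) by (intro mult_mono power_mono) auto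
    then have "4 * (r ^ 2 * s * m) \<le> (r ^ 2 * P) * (r ^ 2 * s * m)" using assms(4) pos by (intro mult_right_mono) auto
    also have "\<dots> \<le> n / 100" using n1 by (simp add: power_def numeral_eq_Suc algebra_simps)
    finally show ?thesis by (simp add: power2_eq_square algebra_simps)
  qed
  \<comment> \<open>r s \<zeta> n is at most 4/25 of itself plus (1/100 + 1/100 + 1/16) n; the 1/16
    is the \<kappa> term, whose factor 1/(r s) cancels here.\<close>
  have rs\<zeta>: "r * s * \<zeta> \<le> 1 / 10"
  proof -
    have "r * s * (\<zeta> * n) = r * s * (r * s * b) + r * s * (r * s ^ 2) + r * s * (4 * r * m) + n / 16"
      unfolding \<zeta> using pos by (simp add: field_simps power2_eq_square)
    also have "\<dots> \<le> r * s * (4 / 25 * n * \<zeta>) + n / 100 + n / 100 + n / 16"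
      using b2 t1 t2 pos by (intro add_mono mult_left_mono) auto
    finally have "n * (21 / 25 * (r * s * \<zeta>)) \<le> n * (1 / 100 + 1 / 100 + 1 / 16)" by (simp add: algebra_simps)
    then have "21 / 25 * (r * s * \<zeta>) \<le> 1 / 100 + 1 / 100 + 1 / 16" using assms(5) by (rule mult_left_le_imp_le)
    then show ?thesis by linarith
  qed
  have "1 * 1 \<le> r * s" using assms(1,2) by (intro mult_mono) auto
  then have "1 * \<zeta> \<le> r * s * \<zeta>" using \<zeta>0 by (intro mult_right_mono) auto
  then have \<zeta>1: "\<zeta> \<le> 1 / 10" using rs\<zeta> by simp
  have "\<zeta> * D \<le> 1 / 10 * D" "r * x * D \<le> 1 / 100 * D" using \<zeta>1 rx assms(8) by (auto intro!: mult_right_mono)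
  then have "1 / 2 * D \<le> D - \<zeta> * D - m * D2" using mD2 assms(8) by linarith
  then have "b' * (1 / 2 * D) \<le> b' * (D - \<zeta> * D - m * D2)" using assms(7) by (intro mult_left_mono) auto
  also have "\<dots> \<le> r * M" by (rule h2)
  also have "\<dots> < r * (s * b' * (\<zeta> * D))" using h2(2) pos by simp
  also have "\<dots> = (r * s * \<zeta>) * (b' * D)" by simp
  also have "\<dots> \<le> 1 / 10 * (b' * D)" using rs\<zeta> assms(7,8) by (intro mult_right_mono) auto
  finally have "b' * D < 0" by linarith
  then show False using assms(7,8) by (smt (verit) mult_nonneg_nonneg)
qed

section \<open>The extremal argument\<close>

lemma card_star_packing_Int_ge:
  assumes "packing B E \<S>" "finite (fst B)" "snd B \<noteq> {}" "\<And>e. e \<in> snd B \<Longrightarrow> e \<subseteq> fst B"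
    and star: "\<And>e. e \<in> E \<Longrightarrow> e \<inter> V1 \<noteq> {}"
  shows "card \<S> \<le> card (\<Union>\<S> \<inter> V1)"
proof -
  have S: "finite S" "S \<inter> V1 \<noteq> {}" if "S \<in> \<S>" for S
  proof -
    have cp: "copy_on B E S" using assms(1) that unfolding packing_def by blast
    then show "finite S" using finite_copy_on assms(2) by blast
    obtain g where g: "bij_betw g (fst B) S" "\<forall>e\<in>snd B. g ` e \<in> E" using cp unfolding copy_on_def by blast
    obtain e where e: "e \<in> snd B" using assms(3) by blast
    have "g ` e \<subseteq> S" using assms(4)[OF e] g(1) unfolding bij_betw_def by blast
    moreover have "g ` e \<inter> V1 \<noteq> {}" using star g(2) e by blast
    ultimately show "S \<inter> V1 \<noteq> {}" by blast
  qed
  have fin: "finite \<S>" and disj: "disjoint \<S>" using assms(1) unfolding packing_def by auto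
  have "card \<S> = (\<Sum>S\<in>\<S>. 1)" by simp
  also have "\<dots> \<le> (\<Sum>S\<in>\<S>. card (S \<inter> V1))"
    using S by (intro sum_mono) (simp add: Suc_leI card_gt_0_iff)
  also have "\<dots> = card (\<Union>S\<in>\<S>. S \<inter> V1)"
  proof (rule card_UN_disjoint[symmetric])
    show "\<forall>S\<in>\<S>. \<forall>S'\<in>\<S>. S \<noteq> S' \<longrightarrow> (S \<inter> V1) \<inter> (S' \<inter> V1) = {}"
      using disj unfolding disjoint_def by blast
  qed (use fin S in auto)
  also have "(\<Union>S\<in>\<S>. S \<inter> V1) = \<Union>\<S> \<inter> V1" by blast
  finally show ?thesis .
qed

text \<open>\<open>C\<close> is covered greedily before the rest is tiled, because the random
  placement handles only vertices of nearly full degree. \<open>big\<close> keeps the part left for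
  tiling large enough for those degrees to survive the restriction.\<close>

lemma extend_star_packing:
  fixes E :: "'a set set"
  assumes V: "finite V" "V1 \<subseteq> V" "card V = s * t + card V1" and r: "2 \<le> r" "r \<le> card V" and P: "1 \<le> P"
    and B: "finite (fst B)" "card (fst B) = s" "fst B \<noteq> {}" "finite (snd B)" "snd B \<noteq> {}" "card (snd B) \<le> P"
      "\<And>e. e \<in> snd B \<Longrightarrow> e \<subseteq> fst B \<and> card e = r"
    and good: "\<And>v. v \<in> V - V1 - C - Q \<Longrightarrow>
      16 * r * P * card {f\<in>nonedges r V E. v \<in> f} \<le> (card V - 1 choose (r - 1))"
    and CQ: "finite C" "finite Q"
    and big: "2 * r * (card V1 + s * (card Q + s + card C) + card Q) \<le> card V"
    and cover: "\<And>Z v. \<lbrakk>Z \<subseteq> V; card Z \<le> s * (card Q + s + card C); v \<in> C; v \<notin> Z\<rbrakk>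
      \<Longrightarrow> \<exists>S. copy_on B E S \<and> v \<in> S \<and> S \<inter> Z = {} \<and> S \<subseteq> V"
    and \<S>0: "packing B {e\<in>E. e \<inter> V1 \<noteq> {}} \<S>0" "card \<S>0 = card Q + s" "\<Union>\<S>0 \<subseteq> V"
  shows "\<exists>\<S>. packing B E \<S> \<and> card \<S> = t + 1 \<and> \<Union>\<S> \<subseteq> V"
proof -
  have pk0: "packing B E \<S>0" using packing_mono[OF \<S>0(1)] by blast
  have "\<exists>\<S>. \<S>0 \<subseteq> \<S> \<and> packing B E \<S> \<and> card \<S> \<le> card \<S>0 + card C \<and> C \<subseteq> \<Union>\<S> \<and> \<Union>\<S> \<subseteq> V"
    using cover by (intro packing_extend_covering pk0 \<S>0(3) CQ(1) B(1,3)) (simp_all add: B(2) \<S>0(2))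
  then obtain \<S> where \<S>: "\<S>0 \<subseteq> \<S>" "packing B E \<S>" "card \<S> \<le> card Q + s + card C" "C \<subseteq> \<Union>\<S>" "\<Union>\<S> \<subseteq> V"
    using \<S>0(2) by auto
  let ?q = "card \<S>"
  show ?thesis
  proof (cases "t + 1 \<le> ?q")
    case True
    then obtain \<S>' where "\<S>' \<subseteq> \<S>" "card \<S>' = t + 1" by (meson obtain_subset_with_card_n)
    then show ?thesis using packing_subset[OF \<S>(2)] \<S>(5) by blast
  next
    case False
    define k where "k = t + 1 - ?q"
    have fV1: "finite V1" using V finite_subset by blast
    have cu: "card (\<Union>\<S>) = s * ?q" and fu: "finite (\<Union>\<S>)" using card_Union_packing[OF \<S>(2) B(1)] B(2) by auto
    have "card Q + s \<le> card (\<Union>\<S>0 \<inter> V1)"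
      unfolding \<S>0(2)[symmetric] using B(7) by (intro card_star_packing_Int_ge[OF \<S>0(1) B(1,5)]) auto
    also have "\<dots> \<le> card (\<Union>\<S> \<inter> V1)" using \<S>(1) fV1 by (intro card_mono) auto
    finally have cV1: "card Q + s \<le> card (\<Union>\<S> \<inter> V1)" .
    define R where "R = V - V1 - \<Union>\<S> - Q"
    have "V \<subseteq> (V1 \<union> \<Union>\<S>) \<union> Q \<union> R" unfolding R_def by blast
    then have "card V \<le> card ((V1 \<union> \<Union>\<S>) \<union> Q \<union> R)"
      using V fV1 fu CQ by (intro card_mono) (auto simp: R_def)
    also have "\<dots> \<le> card (V1 \<union> \<Union>\<S>) + card Q + card R"
      using card_Un_le[of "V1 \<union> \<Union>\<S> \<union> Q" R] card_Un_le[of "V1 \<union> \<Union>\<S>" Q] by linarith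
    finally have c1: "card V \<le> card (V1 \<union> \<Union>\<S>) + card Q + card R" .
    have c2: "card (V1 \<union> \<Union>\<S>) + card (\<Union>\<S> \<inter> V1) = card V1 + s * ?q"
      using card_Un_Int[OF fV1 fu] cu by (simp add: Int_commute)
    \<comment> \<open>V1 and the q copies overlap in at least |Q| + s vertices, so together with Q
      they leave at least s (t + 1 - q) vertices in \<open>R\<close>: just enough for the missing
      copies, with no vertex guaranteed to spare.\<close>
    have "s * t + s \<le> card R + s * ?q" using c1 c2 cV1 V(3) by linarith
    moreover have "s * k + s * ?q = s * t + s"
      unfolding k_def using False by (simp flip: add_mult_distrib2)
    ultimately have kR: "card (fst B) * k \<le> card R" using B(2) by simp
    have "card V - card R \<le> card V1 + s * (card Q + s + card C) + card Q"
    proof -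
      have "s * ?q \<le> s * (card Q + s + card C)" using \<S>(3) by (rule mult_le_mono2)
      then show ?thesis using c1 c2 by linarith
    qed
    then have "2 * r * (card V - card R) \<le> 2 * r * (card V1 + s * (card Q + s + card C) + card Q)"
      by (rule mult_le_mono2)
    then have big': "2 * r * (card V - card R) \<le> card V" using big by linarith
    have goodR: "16 * r * P * card {f\<in>nonedges r V E. v \<in> f} \<le> (card V - 1 choose (r - 1))" if "v \<in> R" for v
      using good[of v] that \<S>(4) unfolding R_def by blast
    have "R \<subseteq> V" unfolding R_def by blast
    obtain \<S>2 where \<S>2: "packing B E \<S>2" "card \<S>2 = k" "\<Union>\<S>2 \<subseteq> R"
      using packing_of_high_degree_vertices[OF V(1) \<open>R \<subseteq> V\<close> r P B(1,3,4,6,7) goodR big' kR] by blast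
    have d: "\<Union>\<S> \<inter> \<Union>\<S>2 = {}" using \<S>2(3) unfolding R_def by blast
    have "card (\<S> \<union> \<S>2) = t + 1"
      using card_packing_Un[OF \<S>(2) \<S>2(1) d B(3)] \<S>2(2) False unfolding k_def by simp
    moreover have "\<Union>(\<S> \<union> \<S>2) \<subseteq> V" using \<S>(5) \<S>2(3) unfolding R_def by blast
    ultimately show ?thesis using packing_Un[OF \<S>(2) \<S>2(1) d] by blast
  qed
qed

lemma card_nonedges:
  assumes "finite V" "\<And>e. e \<in> E \<Longrightarrow> e \<subseteq> V \<and> card e = r"
  shows "card (nonedges r V E) + card E = (card V choose r)"
proof -
  have "{e. e \<subseteq> V \<and> card e = r} = nonedges r V E \<union> E" unfolding nonedges_def using assms(2) by blast
  moreover have "finite E" using assms finite_subset[of E "Pow V"] by blast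
  moreover have "finite (nonedges r V E)" unfolding nonedges_def using assms(1) by simp
  moreover have "nonedges r V E \<inter> E = {}" unfolding nonedges_def by blast
  ultimately show ?thesis using n_subsets[OF assms(1), of r] card_Un_disjoint by metis
qed

lemma degree_nonedges:
  assumes "finite V" "\<And>e. e \<in> E \<Longrightarrow> e \<subseteq> V \<and> card e = r" "v \<in> V" "1 \<le> r"
  shows "card {f\<in>nonedges r V E. v \<in> f} + card {e\<in>E. v \<in> e} = (card V - 1 choose (r - 1))"
proof -
  have "{e. e \<subseteq> V \<and> card e = r \<and> v \<in> e} = {f\<in>nonedges r V E. v \<in> f} \<union> {e\<in>E. v \<in> e}"
    unfolding nonedges_def using assms(2) by blast
  moreover have "finite {e\<in>E. v \<in> e}"
    using assms(1,2) by (intro finite_subset[of "{e\<in>E. v \<in> e}" "Pow V"]) auto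
  moreover have "finite {f\<in>nonedges r V E. v \<in> f}" unfolding nonedges_def using assms(1) by simp
  moreover have "{f\<in>nonedges r V E. v \<in> f} \<inter> {e\<in>E. v \<in> e} = {}" unfolding nonedges_def by blast
  ultimately show ?thesis
    using card_sets_through_vertex[OF assms(1,3,4)] card_Un_disjoint by metis
qed

lemma card_through_vertex_meeting:
  assumes "finite V" "2 \<le> r" "\<And>e. e \<in> G \<Longrightarrow> e \<subseteq> V \<and> card e = r" "X \<subseteq> V" "v \<in> V - X"
  shows "card {e\<in>G. v \<in> e \<and> e \<inter> X \<noteq> {}} \<le> card X * (card V - 2 choose (r - 2))"
proof -
  have finG: "finite G" using assms(1,3) finite_subset[of G "Pow V"] by blast
  have finX: "finite X" using assms(1,4) finite_subset by blast
  have "{e\<in>G. v \<in> e \<and> e \<inter> X \<noteq> {}} = {e\<in>{e\<in>G. v \<in> e}. e \<inter> X \<noteq> {}}" by blast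
  then have "card {e\<in>G. v \<in> e \<and> e \<inter> X \<noteq> {}} \<le> (\<Sum>x\<in>X. card {e\<in>{e\<in>G. v \<in> e}. x \<in> e})"
    using card_meeting_le_sum_degrees[OF finX, of "{e\<in>G. v \<in> e}"] finG by simp
  also have "\<dots> \<le> card X * (card V - 2 choose (r - 2))"
  proof (rule order_trans[OF sum_bounded_above])
    fix x assume "x \<in> X"
    then have "card {e. e \<subseteq> V \<and> card e = r \<and> v \<in> e \<and> x \<in> e} = (card V - 2 choose (r - 2))"
      using assms by (intro card_sets_through_two_vertices) auto
    moreover have "card {e\<in>{e\<in>G. v \<in> e}. x \<in> e} \<le> card {e. e \<subseteq> V \<and> card e = r \<and> v \<in> e \<and> x \<in> e}"
      using assms(1,3) by (intro card_mono) auto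
    ultimately show "card {e\<in>{e\<in>G. v \<in> e}. x \<in> e} \<le> (card V - 2 choose (r - 2))" by simp
  qed simp
  finally show ?thesis .
qed

text \<open>\<open>x\<close> stands for the star number, so that no supremum occurs in the argument,
  and \<open>cover\<close> is the existence of copies through a vertex for this n. The first summand
  is the number of r-sets inside U, which is smaller than the one in the theorem.\<close>

lemma star_edge_bound:
  fixes VB :: "'b set" and EB :: "'b set set" and E :: "nat set set"
  assumes "2 \<le> r" "2 \<le> s" "1 \<le> P" "EB \<noteq> {}" "finite VB" "card VB = s" "finite EB" "card EB \<le> P"
    and EB: "\<And>e. e \<in> EB \<Longrightarrow> e \<subseteq> VB \<and> card e = r"
    and n: "n = s * t + m" "100 * r ^ 4 * s * P * m \<le> n" "100 * r ^ 2 * s ^ 3 \<le> n"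
    and \<kappa>: "\<kappa> = 1 / (16 * real r * real s)"
    and cover: "\<And>Z v. \<lbrakk>v < n; v \<notin> Z; Z \<subseteq> {..<n}; 2 * (card Z + r) \<le> n;
      real (card (nonedges r {..<n} E)) \<le> real m * real (n - 1 choose (r - 1));
      (real r * real (card Z) + 4 * real r * real m + \<kappa> * real n) * real (n - 1 choose (r - 1))
        \<le> real n * real (card {e\<in>E. v \<in> e})\<rbrakk>
      \<Longrightarrow> \<exists>S. copy_on (VB, EB) E S \<and> v \<in> S \<and> S \<inter> Z = {} \<and> S \<subseteq> {..<n}"
    and gr: "rgraph r {..<n} E"
    and free: "\<not> (\<exists>\<S>. packing (VB, EB) E \<S> \<and> card \<S> = t + 1 \<and> \<Union>\<S> \<subseteq> {..<n})"
    and star: "\<And>E'. \<lbrakk>rgraph r {..<n} E'; is_star m n E';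
      \<not> (\<exists>\<S>. packing (VB, EB) E' \<S> \<and> card \<S> = s \<and> \<Union>\<S> \<subseteq> {..<n})\<rbrakk> \<Longrightarrow> card E' \<le> x"
  shows "card E \<le> (s * t choose r) + x"
proof (rule ccontr)
  assume "\<not> card E \<le> (s * t choose r) + x"
  then have large: "(s * t choose r) + x < card E" by simp
  define V where "V = {..<n}"
  have V: "finite V" "card V = n" unfolding V_def by auto
  let ?B = "(VB, EB)"
  have VB: "VB \<noteq> {}" using assms(2,6) by auto
  define D where "D = (n - 1 choose (r - 1))"
  define D2 where "D2 = (n - 2 choose (r - 2))"
  have E: "e \<subseteq> V \<and> card e = r" if "e \<in> E" for e using gr that unfolding rgraph_def V_def by auto
  have finE: "finite E" using E V finite_subset[of E "Pow V"] by blast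
  have K1: "100 * (r ^ 4 * s * P * m) \<le> n" using n(2) by (simp add: algebra_simps)
  have K2: "100 * (r ^ 2 * s ^ 3) \<le> n" using n(3) by simp
  have rs: "r * s ^ 2 \<le> r ^ 2 * s ^ 3"
    using assms(1,2) by (intro mult_mono power_increasing) (auto simp: power2_eq_square)
  have "r * 1 \<le> r * s ^ 2" using assms(2) by (intro mult_le_mono2) (simp add: Suc_leI)
  then have rn: "r \<le> n" "0 < n" using K2 rs assms(1) by linarith+
  have Dpos: "0 < D" unfolding D_def using rn assms(1) by simp
  have nD2: "n * D2 \<le> r * D" unfolding D_def D2_def using choose_codegree_le assms(1) rn(1) by blast
  let ?dg = "\<lambda>v. card {e\<in>E. v \<in> e}"
  let ?M = "nonedges r V E"
  have finM: "finite ?M" unfolding nonedges_def using V by simp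
  have M: "f \<subseteq> V \<and> card f = r" if "f \<in> ?M" for f using that unfolding nonedges_def by blast
  let ?md = "\<lambda>v. card {f\<in>?M. v \<in> f}"
  have mddg: "?md v + ?dg v = D" if "v \<in> V" for v
    using degree_nonedges[OF V(1) E that] assms(1) V(2) unfolding D_def by simp
  \<comment> \<open>More than C(s t, r) edges are present, so fewer than C(n, r) - C(s t, r) \<le> m
    D are missing.\<close>
  have cM: "card ?M \<le> m * D"
  proof -
    obtain j where j: "r = Suc j" using assms(1) by (metis Suc_le_D numeral_2_eq_2)
    have "(n choose r) \<le> (s * t choose r) + m * D"
      unfolding D_def n(1) j using choose_add_le[of "s * t" m j] by simp
    moreover have "card ?M + card E = (n choose r)" using card_nonedges[of V E r] V E by simp
    ultimately show ?thesis using large by linarith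
  qed
  obtain V1 where V1: "V1 \<subseteq> V" "card V1 = m" "\<And>x y. x \<in> V1 \<Longrightarrow> y \<in> V - V1 \<Longrightarrow> ?dg x \<le> ?dg y"
    using exists_subset_of_smallest_values[OF V(1), of m ?dg] V(2) n(1) by auto
  have fV1: "finite V1" using V1 V finite_subset by blast
  define U where "U = V - V1"
  have U: "finite U" "card U = s * t" unfolding U_def using V V1 fV1 n(1) by (auto simp: card_Diff_subset)
  define bad where "bad = {v\<in>U. D < 16 * r * P * ?md v}"
  define b where "b = card bad"
  have finbad: "finite bad" unfolding bad_def using U by simp
  \<comment> \<open>A crude bound from the total number of missing edges, used only to make room;
    the final contradiction needs the sharper bound in terms of \<open>\<zeta>\<close>.\<close>
  have bm: "b \<le> 16 * r ^ 2 * P * m"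
  proof -
    have "b * D \<le> (\<Sum>v\<in>bad. 16 * r * P * ?md v)"
      unfolding b_def using sum_bounded_below[of bad D "\<lambda>v. 16 * r * P * ?md v"] by (simp add: bad_def)
    also have "\<dots> = 16 * r * P * (\<Sum>v\<in>bad. ?md v)" by (simp only: sum_distrib_left)
    also have "\<dots> \<le> 16 * r * P * (r * card ?M)"
      using M V(1) finite_subset by (intro mult_le_mono2 sum_degrees_le[OF finbad finM]) blast
    also have "\<dots> \<le> 16 * r * P * (r * (m * D))" using cM by (intro mult_le_mono2)
    finally have "b * D \<le> (16 * r ^ 2 * P * m) * D" by (simp add: power2_eq_square algebra_simps)
    then show ?thesis using Dpos by simp
  qed
  have room: "2 * r * (m + s * (b + s) + b) \<le> n"
  proof -
    have a1: "r * m \<le> r ^ 4 * s * P * m"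
    proof -
      have "r ^ 1 * 1 * 1 * m \<le> r ^ 4 * s * P * m"
        using assms(1-3) by (intro mult_le_mono power_increasing) auto
      then show ?thesis by simp
    qed
    have a2: "r * (s * b) \<le> 8 * (r ^ 4 * s * P * m)"
    proof -
      have "r * (s * b) \<le> r * (s * (16 * r ^ 2 * P * m))" using bm by (intro mult_le_mono2)
      also have "\<dots> = 8 * (2 * (r ^ 3 * s * P * m))" by (simp add: power_def numeral_eq_Suc algebra_simps)
      also have "\<dots> \<le> 8 * (r * (r ^ 3 * s * P * m))" using assms(1) by (intro mult_le_mono2 mult_le_mono1)
      also have "\<dots> = 8 * (r ^ 4 * s * P * m)" by (simp add: power_def numeral_eq_Suc algebra_simps)
      finally show ?thesis .
    qed
    have a3: "r * b \<le> r * (s * b)" using assms(2) by simp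
    have "2 * r * (m + s * (b + s) + b) = 2 * (r * m) + 2 * (r * (s * b)) + 2 * (r * s ^ 2) + 2 * (r * b)"
      by (simp add: algebra_simps power2_eq_square)
    then show ?thesis using a1 a2 a3 rs K1 K2 by linarith
  qed
  \<comment> \<open>The degree demanded by \<open>cover\<close> for the largest set to be avoided,
    of s (b + s) vertices: |Q| + s star copies and at most |C| covering copies, where |Q| + |C| =
    b.\<close>
  define \<zeta> where "\<zeta> = (real r * (real s * (real b + real s)) + 4 * real r * real m + \<kappa> * real n) / real n"
  have \<zeta>n: "\<zeta> * real n = real r * (real s * (real b + real s)) + 4 * real r * real m + \<kappa> * real n"
    unfolding \<zeta>_def using rn(2) by simp
  define Q where "Q = {v\<in>bad. real (?dg v) < \<zeta> * real D}"
  define C where "C = bad - Q"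
  have finQC: "finite Q" "finite C" "Q \<subseteq> bad" unfolding Q_def C_def using finbad by auto
  have QC: "card Q + card C = b"
    unfolding C_def b_def using finQC finbad by (simp add: card_Diff_subset card_mono)
  define St where "St = {e\<in>E. e \<inter> V1 \<noteq> {}}"
  have StE: "St \<subseteq> E" "finite St" unfolding St_def using finE by auto
  have star_sub: "card E' \<le> x"
    if "E' \<subseteq> St" "\<not> (\<exists>\<S>. packing ?B E' \<S> \<and> card \<S> = s \<and> \<Union>\<S> \<subseteq> V)" for E'
  proof (rule star)
    show "rgraph r {..<n} E'" using gr that(1) StE(1) unfolding rgraph_def by blast
    show "is_star m n E'" unfolding is_star_def
      using V1 that(1) unfolding V_def St_def by blast
  qed (use that(2) V_def in blast)
  have win: False if "packing ?B St \<S>0" "card \<S>0 = card Q + s" "\<Union>\<S>0 \<subseteq> V" for \<S>0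
  proof -
    have CU: "card Q + s + card C = b + s" using QC by simp
    have "\<exists>\<S>. packing ?B E \<S> \<and> card \<S> = t + 1 \<and> \<Union>\<S> \<subseteq> V"
    proof (rule extend_star_packing[OF V(1) V1(1) _ assms(1) _ assms(3)])
      show "packing ?B {e\<in>E. e \<inter> V1 \<noteq> {}} \<S>0" using that(1) unfolding St_def .
      show "16 * r * P * card {f\<in>nonedges r V E. v \<in> f} \<le> (card V - 1 choose (r - 1))"
        if "v \<in> V - V1 - C - Q" for v
        using that unfolding C_def bad_def U_def V(2) D_def by (auto simp: not_less)
      have "card Q \<le> b" using QC by simp
      then have "m + s * (b + s) + card Q \<le> m + s * (b + s) + b" by simp
      then have "2 * r * (m + s * (b + s) + card Q) \<le> 2 * r * (m + s * (b + s) + b)" by (rule mult_le_mono2)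
      then show "2 * r * (card V1 + s * (card Q + s + card C) + card Q) \<le> card V"
        unfolding CU V1(2) V(2) using room by linarith
      show "\<exists>S. copy_on ?B E S \<and> v \<in> S \<and> S \<inter> Z = {} \<and> S \<subseteq> V"
        if Z: "Z \<subseteq> V" "card Z \<le> s * (card Q + s + card C)" "v \<in> C" "v \<notin> Z" for Z v
        unfolding V_def
      proof (rule cover)
        have vU: "v \<in> U" "v \<notin> Q" "v \<in> bad" using Z(3) unfolding C_def bad_def by auto
        then show "v < n" unfolding U_def V_def by simp
        have cZ: "card Z \<le> s * (b + s)" using Z(2) unfolding CU .
        define T where "T = m + s * (b + s) + b"
        have "card Z \<le> T" using cZ unfolding T_def by linarith
        moreover have "4 * T \<le> n"
        proof (rule order_trans)
          show "4 * T \<le> 2 * r * T" using assms(1) by (intro mult_le_mono1) simp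
          show "2 * r * T \<le> n" using room unfolding T_def .
        qed
        moreover have "100 * r \<le> n" using K2 rs \<open>r * 1 \<le> r * s ^ 2\<close> by linarith
        then have "4 * r \<le> n" by simp
        ultimately show "2 * (card Z + r) \<le> n" by simp
        show "real (card (nonedges r {..<n} E)) \<le> real m * real (n - 1 choose (r - 1))"
          using cM unfolding V_def D_def by (metis of_nat_le_iff of_nat_mult)
        have cZ': "real (card Z) \<le> real s * (real b + real s)"
          using cZ by (metis of_nat_add of_nat_le_iff of_nat_mult)
        have "(real r * real (card Z) + 4 * real r * real m + \<kappa> * real n) * real D \<le> (\<zeta> * real n) * real D"
          unfolding \<zeta>n using cZ' by (intro mult_right_mono add_mono mult_left_mono) auto
        also have "\<dots> = real n * (\<zeta> * real D)" by simp
        also have "\<dots> \<le> real n * real (?dg v)"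
          using vU unfolding Q_def by (intro mult_left_mono) auto
        finally show "(real r * real (card Z) + 4 * real r * real m + \<kappa> * real n) * real (n - 1 choose (r - 1))
          \<le> real n * real (card {e\<in>E. v \<in> e})" unfolding D_def .
      qed (use Z V_def in auto)
    qed (use that in \<open>simp_all add: V V1(2) rn(1) assms(4-8) VB EB finQC flip: n(1)\<close>)
    then show False using free unfolding V_def by blast
  qed
  define pk where "pk \<S> \<longleftrightarrow> packing ?B St \<S> \<and> \<Union>\<S> \<subseteq> V" for \<S>
  have lt: "card \<S> < card Q + s" if "pk \<S>" for \<S>
  proof (rule ccontr)
    assume "\<not> card \<S> < card Q + s"
    then obtain \<S>' where S': "\<S>' \<subseteq> \<S>" "card \<S>' = card Q + s" by (metis not_less obtain_subset_with_card_n)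
    have "packing ?B St \<S>'" "\<Union>\<S>' \<subseteq> V" using packing_subset[OF _ S'(1)] that S'(1) unfolding pk_def by blast+
    then show False using win S'(2) by blast
  qed
  have "pk {}" unfolding pk_def using packing_empty by auto
  then obtain \<S> where \<S>: "pk \<S>" "\<And>\<S>'. pk \<S>' \<Longrightarrow> card \<S>' \<le> card \<S>"
    using ex_has_greatest_nat[of pk "{}" card "card Q + s"] lt by (metis less_imp_le)
  let ?p = "card \<S>"
  define MU where "MU = {f\<in>?M. f \<subseteq> U}"
  have finMU: "finite MU" unfolding MU_def using finM by simp
  \<comment> \<open>E has C(s t, r) - |MU| edges inside U, so beating the bound means that the star
    exceeds x by more than |MU|. Missing edges inside U are thus paid for by star edges, which are
    bounded below at \<open>Z\<close> (\<open>hM2\<close>) and at \<open>V1\<close>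
    (\<open>hM1\<close>).\<close>
  have MUSt: "card MU + x < card St"
  proof -
    define EU where "EU = {e\<in>E. e \<subseteq> U}"
    have "card MU + card EU = (s * t choose r)"
    proof -
      have "MU = nonedges r U EU" unfolding MU_def EU_def nonedges_def U_def by blast
      then show ?thesis using card_nonedges[of U EU r] U E unfolding EU_def by auto
    qed
    moreover have "card E = card EU + card St"
    proof -
      have "E = EU \<union> St" "EU \<inter> St = {}" unfolding EU_def St_def U_def using E by blast+
      moreover have "finite EU" unfolding EU_def using finE by simp
      ultimately show ?thesis using StE(2) card_Un_disjoint by metis
    qed
    ultimately show ?thesis using large by linarith
  qed
  have ps: "s \<le> ?p"
  proof (rule ccontr)
    assume "\<not> s \<le> ?p"
    then have "\<not> (\<exists>\<S>. packing ?B St \<S> \<and> card \<S> = s \<and> \<Union>\<S> \<subseteq> V)" using \<S>(2) unfolding pk_def by auto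
    then have "card St \<le> x" using star_sub[of St] by blast
    then show False using MUSt by simp
  qed
  have pQ: "?p < card Q + s" using lt \<S>(1) by blast
  have Q1: "1 \<le> card Q" using ps pQ by linarith
  then obtain u where u: "u \<in> Q" by (metis card.empty ex_in_conv not_one_le_zero)
  \<comment> \<open>The choice of \<open>V1\<close> as the vertices of smallest degree is used here:
    u lies outside \<open>V1\<close> and already has small degree.\<close>
  have dgV1: "real (?dg z) \<le> \<zeta> * real D" if "z \<in> V1" for z
  proof -
    have "u \<in> V - V1" "real (?dg u) < \<zeta> * real D" using u unfolding Q_def bad_def U_def by auto
    then show ?thesis using V1(3)[OF that] by force
  qed
  \<comment> \<open>Here p - s + 1 copies are removed, so that s further copies off their vertices
    would make p + 1 and contradict maximality. As p < |Q| + s, at most |Q| copies are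
    removed.\<close>
  have "?p - s + 1 \<le> ?p" using ps assms(2) by linarith
  then obtain \<S>1 where \<S>1: "\<S>1 \<subseteq> \<S>" "card \<S>1 = ?p - s + 1"
    by (meson obtain_subset_with_card_n)
  have pk1: "packing ?B St \<S>1" "\<Union>\<S>1 \<subseteq> V"
    using packing_subset[OF _ \<S>1(1)] \<S> \<S>1(1) unfolding pk_def by blast+
  define Z where "Z = \<Union>\<S>1"
  have Z: "finite Z" "card Z = s * (?p - s + 1)" "Z \<subseteq> V"
    using card_Union_packing[OF pk1(1)] assms(5,6) \<S>1(2) pk1(2) unfolding Z_def by auto
  have ZQ: "card Z \<le> s * card Q" unfolding Z(2) using pQ ps by (intro mult_le_mono2) linarith
  have St_le: "card St \<le> x + card {e\<in>St. e \<inter> Z \<noteq> {}}"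
  proof -
    define E' where "E' = {e\<in>St. e \<inter> Z = {}}"
    have "\<not> (\<exists>\<S>. packing ?B E' \<S> \<and> card \<S> = s \<and> \<Union>\<S> \<subseteq> V)"
    proof
      assume "\<exists>\<S>. packing ?B E' \<S> \<and> card \<S> = s \<and> \<Union>\<S> \<subseteq> V"
      then have c: "contains (V, E') (copies s ?B)"
        using contains_copies_iff_packing[of ?B V E' s] VB EB by auto
      \<comment> \<open>No edge of \<open>E'\<close> meets \<open>Z\<close>, but isolated vertices
        of a copy may; they must be moved before the copies can join \<open>\<S>1\<close>.\<close>
      have "contains (V - Z, E') (copies s ?B)"
      proof (rule contains_avoiding[OF c V(1)])
        show "finite (fst (copies s ?B))" unfolding copies_def using assms(5) by simp
        show "e \<subseteq> fst (copies s ?B)" if "e \<in> snd (copies s ?B)" for e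
          using that EB unfolding copies_def by auto
        show "e \<inter> Z = {}" if "e \<in> E'" for e using that unfolding E'_def by blast
        have "card Q \<le> b" using QC by simp
        then have "s * card Q + s * s \<le> s * (b + s)" by (simp add: algebra_simps)
        moreover have "s * (b + s) \<le> n"
        proof -
          have "1 * (m + s * (b + s) + b) \<le> 2 * r * (m + s * (b + s) + b)"
            using assms(1) by (intro mult_le_mono1) simp
          then have "1 * (m + s * (b + s) + b) \<le> n" using room by (rule order_trans)
          then show ?thesis by simp
        qed
        ultimately have "card Z + s * s \<le> n" using ZQ by linarith
        then show "card Z + card (fst (copies s ?B)) \<le> card V"
          using V(2) assms(6) unfolding copies_def by (simp add: card_cartesian_product)
      qed (rule Z(1))
      then obtain \<S>' where \<S>': "packing ?B E' \<S>'" "card \<S>' = s" "\<Union>\<S>' \<subseteq> V - Z"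
        using contains_copies_iff_packing[of ?B "V - Z" E' s] VB EB by auto
      have p': "packing ?B St \<S>'" using packing_mono[OF \<S>'(1)] unfolding E'_def by blast
      have d: "\<Union>\<S>1 \<inter> \<Union>\<S>' = {}" using \<S>'(3) unfolding Z_def by blast
      have "pk (\<S>1 \<union> \<S>')" using packing_Un[OF pk1(1) p' d] pk1(2) \<S>'(3) unfolding pk_def by blast
      moreover have "card (\<S>1 \<union> \<S>') = ?p + 1"
        using card_packing_Un[OF pk1(1) p' d] VB \<S>1(2) \<S>'(2) ps by simp
      ultimately show False using \<S>(2) by fastforce
    qed
    then have "card E' \<le> x" using star_sub[of E'] unfolding E'_def by blast
    moreover have "St = E' \<union> {e\<in>St. e \<inter> Z \<noteq> {}}" unfolding E'_def by blast
    then have "card St \<le> card E' + card {e\<in>St. e \<inter> Z \<noteq> {}}" by (metis card_Un_le)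
    ultimately show ?thesis by linarith
  qed
  have mD2: "real m * real D2 \<le> \<zeta> * real D"
  proof -
    have "real n * (real m * real D2) = real m * real (n * D2)" by simp
    also have "\<dots> \<le> real m * real (r * D)" using nD2 by (intro mult_left_mono) (simp_all only: of_nat_le_iff of_nat_0_le_iff)
    also have "\<dots> = (real r * real m) * real D" by simp
    also have "\<dots> \<le> (\<zeta> * real n) * real D"
    proof (rule mult_right_mono)
      have "0 \<le> real r * (real s * (real b + real s))" "0 \<le> \<kappa> * real n" "0 \<le> real r * real m" using \<kappa> by auto
      then show "real r * real m \<le> \<zeta> * real n" unfolding \<zeta>n by linarith
    qed simp
    also have "\<dots> = real n * (\<zeta> * real D)" by simp
    finally show ?thesis using rn(2) by (simp add: mult_le_cancel_left)
  qed
  \<comment> \<open>A vertex of V1 has small degree by \<open>dgV1\<close>. A star edge at any other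
    vertex also contains one of the m vertices of V1, which leaves at most m D2 choices.\<close>
  have degSt: "real (card {e\<in>St. z \<in> e}) \<le> \<zeta> * real D" if "z \<in> Z" for z
  proof (cases "z \<in> V1")
    case True
    have "card {e\<in>St. z \<in> e} \<le> ?dg z" using finE StE(1) by (intro card_mono) auto
    then show ?thesis using dgV1[OF True] by linarith
  next
    case False
    have "{e\<in>St. z \<in> e} = {e\<in>E. z \<in> e \<and> e \<inter> V1 \<noteq> {}}" unfolding St_def by blast
    then have "card {e\<in>St. z \<in> e} \<le> m * D2"
      using card_through_vertex_meeting[of V r E V1 z] assms(1) E V1(1) False that Z(3) V1(2) V
      unfolding D2_def by auto
    then have "real (card {e\<in>St. z \<in> e}) \<le> real m * real D2" by (metis of_nat_le_iff of_nat_mult)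
    then show ?thesis using mD2 by linarith
  qed
  have \<zeta>D: "0 \<le> \<zeta> * real D" using mD2 by (smt (verit) mult_nonneg_nonneg of_nat_0_le_iff)
  have hM2: "real (card MU) < real s * real (card Q) * (\<zeta> * real D)"
  proof -
    have "card {e\<in>St. e \<inter> Z \<noteq> {}} \<le> (\<Sum>z\<in>Z. card {e\<in>St. z \<in> e})"
      by (rule card_meeting_le_sum_degrees[OF Z(1) StE(2)])
    then have "real (card {e\<in>St. e \<inter> Z \<noteq> {}}) \<le> (\<Sum>z\<in>Z. real (card {e\<in>St. z \<in> e}))"
      by (simp only: of_nat_sum[symmetric] of_nat_le_iff)
    also have "\<dots> \<le> real (card Z) * (\<zeta> * real D)" using degSt by (rule sum_bounded_above)
    also have "\<dots> \<le> real (s * card Q) * (\<zeta> * real D)" using ZQ \<zeta>D by (intro mult_right_mono) (simp_all only: of_nat_le_iff)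
    finally have "real (card {e\<in>St. e \<inter> Z \<noteq> {}}) \<le> real s * real (card Q) * (\<zeta> * real D)" by simp
    moreover have "card MU < card {e\<in>St. e \<inter> Z \<noteq> {}}" using St_le MUSt by linarith
    ultimately show ?thesis by linarith
  qed
  have hM1: "real (card MU) \<le> real m * (\<zeta> * real D)"
  proof -
    have "St = {e\<in>E. e \<inter> V1 \<noteq> {}}" by (rule St_def)
    then have "card St \<le> (\<Sum>v\<in>V1. ?dg v)" using card_meeting_le_sum_degrees[OF fV1 finE] by simp
    then have "real (card St) \<le> (\<Sum>v\<in>V1. real (?dg v))"
      by (simp only: of_nat_sum[symmetric] of_nat_le_iff)
    also have "\<dots> \<le> real (card V1) * (\<zeta> * real D)" using dgV1 by (rule sum_bounded_above)
    finally show ?thesis using MUSt V1(2) by simp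
  qed
  \<comment> \<open>A missing edge at v that leaves U contains one of the m vertices of V1; at most
    m D2 are lost in this way.\<close>
  have mdU: "real (?md v) - real m * real D2 \<le> real (card {f\<in>MU. v \<in> f})" if "v \<in> U" for v
  proof -
    have "{f\<in>?M. v \<in> f} \<subseteq> {f\<in>MU. v \<in> f} \<union> {f\<in>?M. v \<in> f \<and> f \<inter> V1 \<noteq> {}}"
      unfolding MU_def U_def using M by blast
    then have "?md v \<le> card ({f\<in>MU. v \<in> f} \<union> {f\<in>?M. v \<in> f \<and> f \<inter> V1 \<noteq> {}})"
      using finM finMU by (intro card_mono) auto
    also have "\<dots> \<le> card {f\<in>MU. v \<in> f} + card {f\<in>?M. v \<in> f \<and> f \<inter> V1 \<noteq> {}}" by (rule card_Un_le)
    also have "card {f\<in>?M. v \<in> f \<and> f \<inter> V1 \<noteq> {}} \<le> m * D2"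
      using card_through_vertex_meeting[of V r ?M V1 v] assms(1) M V1(1) that V1(2) V
      unfolding D2_def U_def by simp
    finally have "?md v \<le> card {f\<in>MU. v \<in> f} + m * D2" by simp
    then have "real (?md v) \<le> real (card {f\<in>MU. v \<in> f} + m * D2)" by (simp only: of_nat_le_iff)
    then show ?thesis by simp
  qed
  have lower: "real (card X) * (y - real m * real D2) \<le> real r * real (card MU)"
    if X: "X \<subseteq> U" "\<And>v. v \<in> X \<Longrightarrow> y \<le> real (?md v)" for X y
  proof -
    have fX: "finite X" using X(1) U(1) finite_subset by blast
    have "real (card X) * (y - real m * real D2) \<le> (\<Sum>v\<in>X. real (card {f\<in>MU. v \<in> f}))"
    proof (rule sum_bounded_below)
      fix v assume "v \<in> X"
      then show "y - real m * real D2 \<le> real (card {f\<in>MU. v \<in> f})" using mdU[of v] X by fastforce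
    qed
    also have "\<dots> = real (\<Sum>v\<in>X. card {f\<in>MU. v \<in> f})" by simp
    also have "\<dots> \<le> real (r * card MU)"
    proof (subst of_nat_le_iff, rule sum_degrees_le[OF fX finMU])
      show "finite e \<and> card e = r" if "e \<in> MU" for e
        using that M[of e] finite_subset[OF _ V(1)] unfolding MU_def by blast
    qed
    finally show ?thesis by simp
  qed
  show False
  proof (rule stability_constants_contradiction[where r = "real r" and s = "real s" and P = "real P"
        and m = "real m" and n = "real n" and b = "real b" and b' = "real (card Q)" and \<zeta> = \<zeta>
        and D = "real D" and ?D2.0 = "real D2" and M = "real (card MU)"])
    show "100 * real r ^ 4 * real s * real P * real m \<le> real n"
      using of_nat_mono[OF n(2), where 'a = real] by simp
    show "100 * real r ^ 2 * real s ^ 3 \<le> real n"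
      using of_nat_mono[OF n(3), where 'a = real] by simp
    show "\<zeta> * real n = real r * (real s * (real b + real s)) + 4 * real r * real m + real n / (16 * real r * real s)"
      unfolding \<zeta>n \<kappa> by simp
    show "real n * real D2 \<le> real r * real D" using nD2 by (metis of_nat_le_iff of_nat_mult)
    show "real b * (real D / (16 * real r * real P) - real m * real D2) \<le> real r * real (card MU)"
      unfolding b_def
    proof (rule lower)
      show "bad \<subseteq> U" unfolding bad_def by blast
      fix v assume "v \<in> bad"
      then have "D \<le> 16 * r * P * ?md v" unfolding bad_def by simp
      then have "real D \<le> real (16 * r * P * ?md v)" by (simp only: of_nat_le_iff)
      then show "real D / (16 * real r * real P) \<le> real (?md v)"
        using assms(1,3) by (simp add: divide_le_eq algebra_simps)
    qed
    show "real (card Q) * (real D - \<zeta> * real D - real m * real D2) \<le> real r * real (card MU)"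
    proof (rule lower)
      show "Q \<subseteq> U" unfolding Q_def bad_def by blast
      fix v assume "v \<in> Q"
      then have "real (?dg v) < \<zeta> * real D" "v \<in> V" unfolding Q_def bad_def U_def by auto
      then show "real D - \<zeta> * real D \<le> real (?md v)" using mddg[of v] by linarith
    qed
  qed (use assms(1-3) rn Dpos Q1 hM1 hM2 in auto)
qed

theorem theorem1p15:
  fixes r :: nat and sz :: "nat \<Rightarrow> nat" and VB :: "'b set" and EB :: "'b set set"
  assumes "r \<ge> 2"
    and "\<forall>i j. i \<le> j \<longrightarrow> j < r \<longrightarrow> sz i \<le> sz j"
    and "sz 0 \<ge> 1"
    and "rpartite r sz VB EB"
  shows "\<exists>n0. \<forall>n\<ge>n0. \<forall>t::nat.
           real n / real (\<Sum>i<r. sz i)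
             - real n / (16 * exp 1 ^ 2 * real r ^ 4 * real (\<Sum>i<r. sz i) ^ 2 * (\<Prod>i<r. real (sz i)))
             \<le> real t
           \<and> real t \<le> real n / real (\<Sum>i<r. sz i)
           \<longrightarrow> ex_num r n (copies (t + 1) (VB, EB))
               \<le> ((\<Sum>i<r. sz i) * (t + 1) - 1 choose r)
                  + ex_star r (n - (\<Sum>i<r. sz i) * t) n (copies (\<Sum>i<r. sz i) (VB, EB))"
proof -
  define s where "s = (\<Sum>i<r. sz i)"
  define P where "P = (\<Prod>i<r. sz i)"
  have sz1: "1 \<le> sz i" if "i < r" for i using assms(2,3) that by (metis le0 le_trans)
  have "(\<Sum>i<r. 1) \<le> s" unfolding s_def using sz1 by (intro sum_mono) auto
  then have s2: "2 \<le> s" using assms(1) by simp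
  have P1: "1 \<le> P" unfolding P_def using sz1 by (intro prod_ge_1) auto
  have rP: "(\<Prod>i<r. real (sz i)) = real P" unfolding P_def by simp
  obtain W where "rpartition r sz W VB EB" using assms(4) unfolding rpartite_iff_rpartition by blast
  note W = rpartitionD[OF this]
  have cVB: "card VB = s" using rpartite_card_vertices[OF assms(4)] unfolding s_def .
  have cEB: "card EB \<le> P" "finite EB" using rpartite_card_edges_le[OF assms(4)] unfolding P_def .
  have VB: "VB \<noteq> {}" using cVB s2 by auto
  have cc: "contains (V, E) (copies k (VB, EB)) \<longleftrightarrow> (\<exists>\<S>. packing (VB, EB) E \<S> \<and> card \<S> = k \<and> \<Union>\<S> \<subseteq> V)"
    for V :: "nat set" and E k
    using contains_copies_iff_packing[of "(VB, EB)" V E k] VB W(7) by auto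
  define \<kappa> where "\<kappa> = 1 / (16 * real r * real s)"
  have "\<kappa> > 0" unfolding \<kappa>_def using assms(1) s2 by simp
  from exists_copy_through_vertex[OF assms(1,4,3) this]
  obtain n1 where n1: "\<And>n E Z v m. \<lbrakk>n1 \<le> n; rgraph r {..<n} E; v < n; v \<notin> Z; Z \<subseteq> {..<n}; 2 * (card Z + r) \<le> n;
      real (card (nonedges r {..<n} E)) \<le> real m * real (n - 1 choose (r - 1));
      (real r * real (card Z) + 4 * real r * real m + \<kappa> * real n) * real (n - 1 choose (r - 1))
        \<le> real n * real (card {e\<in>E. v \<in> e})\<rbrakk>
      \<Longrightarrow> \<exists>S. copy_on (VB, EB) E S \<and> v \<in> S \<and> S \<inter> Z = {} \<and> S \<subseteq> {..<n}"
    by blast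
  \<comment> \<open>The second term absorbs the s^2 vertices taken up by the s spare star
    copies.\<close>
  define n0 where "n0 = max n1 (100 * r ^ 2 * s ^ 3)"
  show ?thesis
    unfolding s_def[symmetric] rP
  proof (rule exI[of _ n0], intro allI impI, elim conjE)
    fix n t :: nat
    assume n: "n0 \<le> n" and lo: "real n / real s - real n / (16 * exp 1 ^ 2 * real r ^ 4 * real s ^ 2 * real P) \<le> real t"
      and hi: "real t \<le> real n / real s"
    have "real s * real t \<le> real n" using hi s2 by (simp add: field_simps)
    then have st: "s * t \<le> n" by (metis of_nat_le_iff of_nat_mult)
    define m where "m = n - s * t"
    have nm: "n = s * t + m" using st m_def by simp
    have finE: "finite {E. rgraph r {..<n} E}"
      by (rule finite_subset[of _ "Pow (Pow {..<n})"]) (auto simp: rgraph_def)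
    let ?X = "ex_star r m n (copies s (VB, EB))"
    have star: "card E' \<le> ?X" if "rgraph r {..<n} E'" "is_star m n E'"
      "\<not> (\<exists>\<S>. packing (VB, EB) E' \<S> \<and> card \<S> = s \<and> \<Union>\<S> \<subseteq> {..<n})" for E'
      unfolding ex_star_def
    proof (rule cSup_upper)
      show "card E' \<in> {card E | E. rgraph r {..<n} E \<and> is_star m n E \<and> \<not> contains ({..<n}, E) (copies s (VB, EB))}"
        using that unfolding cc by blast
      have "finite {card E | E. rgraph r {..<n} E \<and> is_star m n E \<and> \<not> contains ({..<n}, E) (copies s (VB, EB))}"
        by (rule finite_subset[OF _ finite_imageI[OF finE, of card]]) auto
      then show "bdd_above {card E | E. rgraph r {..<n} E \<and> is_star m n E \<and> \<not> contains ({..<n}, E) (copies s (VB, EB))}"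
        by (rule bdd_above_finite)
    qed
    have each: "card E \<le> (s * (t + 1) - 1 choose r) + ?X"
      if gr: "rgraph r {..<n} E" and free: "\<not> contains ({..<n}, E) (copies (t + 1) (VB, EB))" for E
    \<comment> \<open>With fewer than s (t + 1) vertices there is no room for t + 1 copies and all
      r-sets may be edges; the first binomial coefficient of the theorem accounts for this
      case.\<close>
    proof (cases "n < s * (t + 1)")
      case True
      have "card E \<le> (n choose r)"
        using card_nonedges[of "{..<n}" E r] gr unfolding rgraph_def by auto
      also have "\<dots> \<le> (s * (t + 1) - 1 choose r)" using True by (intro binomial_right_mono) simp
      finally show ?thesis by simp
    next
      case False
      \<comment> \<open>A copy meets V1 only through an edge. An edgeless graph would fit t + 1
        times on this many vertices.\<close>
      have "EB \<noteq> {}"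
      proof
        assume "EB = {}"
        have "card ({..<t + 1} \<times> VB) \<le> card {..<n}"
          using False cVB by (simp add: card_cartesian_product mult.commute)
        then obtain f where "inj_on f ({..<t + 1} \<times> VB)" "f ` ({..<t + 1} \<times> VB) \<subseteq> {..<n}"
          using card_le_inj[of "{..<t + 1} \<times> VB" "{..<n}"] W(6) by auto
        then have "contains ({..<n}, E) (copies (t + 1) (VB, EB))"
          unfolding contains_def copies_def \<open>EB = {}\<close> by auto
        then show False using free by blast
      qed
      have big: "100 * r ^ 4 * s * P * m \<le> n"
      proof -
        \<comment> \<open>Of Euler's number only e \<ge> 5/2 is used, which gives 16 e^2 \<ge>
          100.\<close>
        have "1 + 1 + 1\<^sup>2 / 2 \<le> exp (1::real)" by (rule exp_lower_Taylor_quadratic) simp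
        then have "(5 / 2)\<^sup>2 \<le> exp (1::real) ^ 2" by (intro power_mono) auto
        then have e: "100 \<le> 16 * exp (1::real) ^ 2" by (simp add: power2_eq_square)
        have pos: "0 < real r ^ 4 * real s ^ 2 * real P" using assms(1) s2 P1 by simp
        have "real n / (16 * exp 1 ^ 2 * real r ^ 4 * real s ^ 2 * real P)
            \<le> real n / (100 * (real r ^ 4 * real s ^ 2 * real P))"
        proof (rule divide_left_mono)
          show "100 * (real r ^ 4 * real s ^ 2 * real P) \<le> 16 * exp 1 ^ 2 * real r ^ 4 * real s ^ 2 * real P"
            using mult_right_mono[OF e, of "real r ^ 4 * real s ^ 2 * real P"] by (simp only: mult.assoc) simp
        qed (use assms(1) s2 P1 in simp_all)
        then have "real n / real s - real t \<le> real n / (100 * (real r ^ 4 * real s ^ 2 * real P))" using lo by linarith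
        then have "real s * (real n / real s - real t) \<le> real s * (real n / (100 * (real r ^ 4 * real s ^ 2 * real P)))"
          by (intro mult_left_mono) auto
        moreover have "real s * (real n / real s - real t) = real m"
          using s2 nm by (simp add: right_diff_distrib)
        moreover have "real s * (real n / (100 * (real r ^ 4 * real s ^ 2 * real P))) = real n / (100 * (real r ^ 4 * real s * real P))"
          using s2 by (simp add: power2_eq_square)
        ultimately have "real m \<le> real n / (100 * (real r ^ 4 * real s * real P))" by simp
        then have "real (100 * r ^ 4 * s * P * m) \<le> real n"
          using assms(1) s2 P1 by (simp add: pos_le_divide_eq algebra_simps)
        then show ?thesis by (simp only: of_nat_le_iff)
      qed
      have "card E \<le> (s * t choose r) + ?X"
      proof (rule star_edge_bound[OF assms(1) s2 P1 \<open>EB \<noteq> {}\<close> W(6) cVB cEB(2,1) W(7) nm big _ \<kappa>_def _ gr])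
        show "100 * r ^ 2 * s ^ 3 \<le> n" using n unfolding n0_def by simp
      next
        fix Z v
        assume "v < n" "v \<notin> Z" "Z \<subseteq> {..<n}" "2 * (card Z + r) \<le> n"
          "real (card (nonedges r {..<n} E)) \<le> real m * real (n - 1 choose (r - 1))"
          "(real r * real (card Z) + 4 * real r * real m + \<kappa> * real n) * real (n - 1 choose (r - 1))
            \<le> real n * real (card {e\<in>E. v \<in> e})"
        then show "\<exists>S. copy_on (VB, EB) E S \<and> v \<in> S \<and> S \<inter> Z = {} \<and> S \<subseteq> {..<n}"
          using n1[OF _ gr] n unfolding n0_def by auto
      next
        show "\<not> (\<exists>\<S>. packing (VB, EB) E \<S> \<and> card \<S> = t + 1 \<and> \<Union>\<S> \<subseteq> {..<n})"
          using free unfolding cc .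
      qed (blast, rule star)
      moreover have "(s * t choose r) \<le> (s * (t + 1) - 1 choose r)"
        using s2 by (intro binomial_right_mono) simp
      ultimately show ?thesis by linarith
    qed
    show "ex_num r n (copies (t + 1) (VB, EB)) \<le> (s * (t + 1) - 1 choose r) + ex_star r (n - s * t) n (copies s (VB, EB))"
    \<comment> \<open>No free graph exists if \<open>EB\<close> is empty and n \<ge> s (t + 1); the
      supremum of the empty set of naturals is then 0.\<close>
    proof (cases "{card E | E. rgraph r {..<n} E \<and> \<not> contains ({..<n}, E) (copies (t + 1) (VB, EB))} = {}")
      case True
      then show ?thesis unfolding ex_num_def by (simp only: True Sup_nat_empty)
    next
      case False
      then show ?thesis unfolding ex_num_def m_def[symmetric] using each by (intro cSup_least) auto
    qed
  qed
qed

end
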